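(* Consider the stochastic block model $G_N$ with $M$ blocks of equal size $N/M$, intra-block edge probabilities $p_1(N)\ge\dots\ge p_M(N)$ and inter-block edge probability $q(N)$, with $\gamma_m,\gamma_{\min},\gamma_{\max},p_{\min},p_{\max}$ as defined in the context. Assume that for every $m=1,\dots,M$ $$\frac{M\log^4 N}{Np_m+N(M-1)q}\cdot\frac{\gamma_{\max}^2}{\gamma_{\min}^2}\xrightarrow[N\to\infty]{}0,$$ that $$((M-1)q)^2\gg\Big(\frac{M\log N}{N}\Big)^{1/4}p_{\min}^{5/4}\,p_{\max}^{1/2},$$ and that the limit $\kappa=\lim_{N\to\infty}\frac{(M-1)q}{p_{\min}}\in[0,\infty]$ exists. Then, for $w\in V_N$, $$H_w=\frac NM\,\frac{\sum_{m=1}^M\gamma_m}{\gamma_{B(w)}}\,(1+o(1))$$ asymptotically almost surely.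
   Context: Model: $M$ is the (fixed) number of blocks and $N\to\infty$ runs through multiples of $M$ with $M<N$. The vertex set $V=V_N=\{1,\dots,N\}$ is partitioned into blocks $V^{(1)},\dots,V^{(M)}$ of size $N/M$ each; $B(v)$ denotes the number of the block containing $v$. $p_1\ge\dots\ge p_M$ and $q$ are numbers in $[0,1]$ depending on $N$ (the argument $N$ is often suppressed). In the random graph $G_N=(V_N,E_N)$ the edge indicators $\varepsilon_{v,w}\in\{0,1\}$ of the unordered pairs $\{v,w\}$ (loops $v=w$ allowed) are independent; $\varepsilon_{v,w}=1$ with probability $p_m$ if $v,w$ are both in $V^{(m)}$, and with probability $q$ if they are in different blocks. Put $a_{v,w}=\varepsilon_{v,w}$ and $d_v=\sum_{w\in V}a_{v,w}$ (a loop counts once). $E$ is the edge set (including loops) and $L$ the set of loops, so $\sum_v d_v=2|E|-|L|$. Parameters: $\gamma_m=\frac NM p_m+(M-1)\frac NM q$ (expected degree of a vertex in block $m$), $\gamma_{\min}=\min_m\gamma_m$, $\gamma_{\max}=\max_m\gamma_m$, $p_{\min}=\min_m p_m=p_M$, $p_{\max}=\max_m p_m=p_1$. Random walk: for a realization of $G_N$, the simple random walk in discrete time jumps from $v$ to $w$ with probability $1/d_v$ if $\{v,w\}\in E$, and $0$ otherwise. Its invariant distribution is $\pi_v=d_v/(2|E|-|L|)$. $H_{vw}$ is the expected time for the walk started in $v$ to reach $w$ (so $H_{ww}=0$), a random variable through the graph. Define $H_w=\sum_{v\in V}\pi_vH_{vw}$. The realization is tacitly assumed connected (under the hypotheses this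 has probability tending to $1$). Conventions: $a_N\ll b_N$ (equivalently $b_N\gg a_N$) means $a_N/b_N\to0$. An event holds asymptotically almost surely (a.a.s.) if its probability tends to $1$ as $N\to\infty$; "$X_N=x_N(1+o(1))$ a.a.s." means that there is a deterministic sequence $\delta_N\to0$ with $|X_N/x_N-1|\le\delta_N$ a.a.s. *)

theory Defs
  imports "HOL-Probability.Probability"
begin

subsection \<open>Asymptotics along the multiples of the number of blocks\<close>

definition block_filter :: "nat \<Rightarrow> nat filter" where
  "block_filter M = inf sequentially (principal {N. M dvd N \<and> M < N})"

text \<open>\<open>much_less F a b\<close> is \<open>a \<lless> b\<close>, i.e. \<open>a / b \<longlonglongrightarrow> 0\<close>. As \<open>x / 0 = 0\<close> in HOL, the quotient has to be
  required to be meaningful.\<close>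

definition much_less :: "nat filter \<Rightarrow> (nat \<Rightarrow> real) \<Rightarrow> (nat \<Rightarrow> real) \<Rightarrow> bool" where
  "much_less F a b \<longleftrightarrow> (\<forall>\<^sub>F N in F. b N \<noteq> 0) \<and> ((\<lambda>N. a N / b N) \<longlongrightarrow> 0) F"


subsection \<open>The stochastic block model\<close>

definition vertices :: "nat \<Rightarrow> nat set" where
  "vertices N = {1..N}"

text \<open>Unordered pairs are sets \<open>{v, w}\<close>; a loop at \<open>v\<close> is the singleton \<open>{v}\<close>.\<close>

definition vertex_pairs :: "nat \<Rightarrow> nat set set" where
  "vertex_pairs N = {{v, w} | v w. v \<in> vertices N \<and> w \<in> vertices N}"

text \<open>\<open>B v\<close> is the number, in \<open>{1..M}\<close>, of the block containing \<open>v\<close>.\<close>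

definition equal_blocks :: "nat \<Rightarrow> nat \<Rightarrow> (nat \<Rightarrow> nat) \<Rightarrow> bool" where
  "equal_blocks M N B \<longleftrightarrow>
     B ` vertices N \<subseteq> {1..M} \<and> (\<forall>m\<in>{1..M}. card {v \<in> vertices N. B v = m} = N div M)"

text \<open>The endpoints of \<open>e\<close> lie in one common block iff \<open>B ` e\<close> is a singleton.\<close>

definition edge_prob :: "(nat \<Rightarrow> nat) \<Rightarrow> (nat \<Rightarrow> real) \<Rightarrow> real \<Rightarrow> nat set \<Rightarrow> real" where
  "edge_prob B p q e = (if is_singleton (B ` e) then p (the_elem (B ` e)) else q)"

text \<open>The law of the random edge set.\<close>

definition sbm :: "nat \<Rightarrow> (nat \<Rightarrow> nat) \<Rightarrow> (nat \<Rightarrow> real) \<Rightarrow> real \<Rightarrow> nat set set pmf" where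
  "sbm N B p q =
     map_pmf (\<lambda>\<epsilon>. {e \<in> vertex_pairs N. \<epsilon> e})
       (Pi_pmf (vertex_pairs N) False (\<lambda>e. bernoulli_pmf (edge_prob B p q e)))"

definition block_degree :: "nat \<Rightarrow> nat \<Rightarrow> (nat \<Rightarrow> real) \<Rightarrow> real \<Rightarrow> nat \<Rightarrow> real" where
  "block_degree M N p q m = real N / real M * p m + (real M - 1) * (real N / real M) * q"

definition block_degree_min :: "nat \<Rightarrow> nat \<Rightarrow> (nat \<Rightarrow> real) \<Rightarrow> real \<Rightarrow> real" where
  "block_degree_min M N p q = (MIN m\<in>{1..M}. block_degree M N p q m)"

definition block_degree_max :: "nat \<Rightarrow> nat \<Rightarrow> (nat \<Rightarrow> real) \<Rightarrow> real \<Rightarrow> real" where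
  "block_degree_max M N p q = (MAX m\<in>{1..M}. block_degree M N p q m)"


subsection \<open>Simple random walk and hitting times\<close>

definition adj :: "nat set set \<Rightarrow> nat \<Rightarrow> nat \<Rightarrow> nat" where
  "adj E v w = of_bool ({v, w} \<in> E)"

definition vdegree :: "nat \<Rightarrow> nat set set \<Rightarrow> nat \<Rightarrow> nat" where
  "vdegree N E v = (\<Sum>w\<in>vertices N. adj E v w)"

definition loops :: "nat set set \<Rightarrow> nat set set" where
  "loops E = {e \<in> E. is_singleton e}"

definition graph_connected :: "nat \<Rightarrow> nat set set \<Rightarrow> bool" where
  "graph_connected N E \<longleftrightarrow>
     (\<forall>v\<in>vertices N. \<forall>w\<in>vertices N.
        (v, w) \<in> {(x, y). x \<in> vertices N \<and> y \<in> vertices N \<and> {x, y} \<in> E}\<^sup>*)"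

definition invariant_dist :: "nat \<Rightarrow> nat set set \<Rightarrow> nat \<Rightarrow> real" where
  "invariant_dist N E v =
     real (vdegree N E v) / (2 * real (card E) - real (card (loops E)))"

text \<open>The uniform distribution on the neighbours. It is unspecified at an isolated vertex; such a
  vertex does not occur in a connected graph with at least two vertices.\<close>

definition srw_step :: "nat \<Rightarrow> nat set set \<Rightarrow> nat \<Rightarrow> nat pmf" where
  "srw_step N E v = pmf_of_set {w \<in> vertices N. {v, w} \<in> E}"

text \<open>The law on trajectories \<open>nat \<Rightarrow> 'a\<close> of the Markov chain with transition kernel \<open>K\<close> started in
  \<open>v\<close>, obtained from the Ionescu-Tulcea theorem: given the first \<open>n\<close> positions \<open>\<omega> 0, \<dots>, \<omega> (n - 1)\<close>,
  the next one has law \<open>markov_kernel K v n \<omega>\<close>.\<close>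

definition markov_kernel :: "('a \<Rightarrow> 'a pmf) \<Rightarrow> 'a \<Rightarrow> nat \<Rightarrow> (nat \<Rightarrow> 'a) \<Rightarrow> 'a measure" where
  "markov_kernel K v n \<omega> = measure_pmf (if n = 0 then return_pmf v else K (\<omega> (n - 1)))"

lemma Ionescu_Tulcea_markov_kernel:
  fixes K :: "'a \<Rightarrow> 'a pmf"
  shows "Ionescu_Tulcea (markov_kernel K v) (\<lambda>_. count_space UNIV)"
proof (rule Ionescu_Tulcea.intro)
  fix i :: nat
  show "markov_kernel K v i \<in>
      measurable (PiM {0..<i} (\<lambda>_. count_space UNIV)) (subprob_algebra (count_space UNIV))"
  proof (cases "i = 0")
    case True
    then show ?thesis
      by (simp add: markov_kernel_def[abs_def] measurable_def measure_pmf_in_subprob_algebra)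
  next
    case False
    have c: "(\<lambda>\<omega>. \<omega> (i - 1)) \<in> measurable (PiM {0..<i} (\<lambda>_. count_space UNIV)) (count_space UNIV)"
      using False by (intro measurable_component_singleton) auto
    have k: "(\<lambda>x. measure_pmf (K x)) \<in> measurable (count_space UNIV) (subprob_algebra (count_space UNIV))"
      by (simp add: measure_pmf_in_subprob_algebra)
    show ?thesis
      using measurable_compose[OF c k] False by (simp add: markov_kernel_def[abs_def])
  qed
next
  fix i :: nat and x :: "nat \<Rightarrow> 'a"
  show "prob_space (markov_kernel K v i x)"
    by (simp add: markov_kernel_def measure_pmf.prob_space_axioms)
qed

definition markov_law :: "('a \<Rightarrow> 'a pmf) \<Rightarrow> 'a \<Rightarrow> (nat \<Rightarrow> 'a) measure" where
  "markov_law K v =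
     projective_family.lim UNIV
       (Ionescu_Tulcea.CI (markov_kernel K v) (\<lambda>_. count_space UNIV)) (\<lambda>_. count_space UNIV)"

text \<open>First time at which the trajectory visits \<open>w\<close> (time \<open>0\<close> included), \<open>\<infinity>\<close> if it never does.\<close>

definition hitting_time :: "'a \<Rightarrow> (nat \<Rightarrow> 'a) \<Rightarrow> ennreal" where
  "hitting_time w \<omega> = (INF n\<in>{n. \<omega> n = w}. of_nat n)"

definition exp_hitting_time :: "nat \<Rightarrow> nat set set \<Rightarrow> nat \<Rightarrow> nat \<Rightarrow> ennreal" where
  "exp_hitting_time N E v w = (\<integral>\<^sup>+ \<omega>. hitting_time w \<omega> \<partial>markov_law (srw_step N E) v)"

definition avg_hitting_time :: "nat \<Rightarrow> nat set set \<Rightarrow> nat \<Rightarrow> ennreal" where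
  "avg_hitting_time N E w =
     (\<Sum>v\<in>vertices N. ennreal (invariant_dist N E v) * exp_hitting_time N E v w)"

end

(*
The graph Laplacian L = D - A turns expected hitting times h(v) = H_vw into the solution of h(w) = 0,
L h = d off w. Summing L h over all vertices gives (L h)(w) = d_w - S with S = 2|E| - |L|, so the
Dirichlet energy of h is S H_w. Testing h against the indicator of w (energy at most d_w) yields the
deterministic lower bound H_w >= S/d_w (1 - d_w/S)^2. For the upper bound, write
H_w = <pi - delta_w, h> and split off one step of the walk: delta_w - delta_w P costs at most
sqrt(energy/d_w), while delta_w P - pi has squared norm O(1/d_w) and is therefore controlled by the
combinatorial spectral gap. Hence H_w <= S/d_w (1 + o(1)) as soon as the gap of L tends to infinity.

By monotonicity of the energy it suffices to bound the gap of the graph of inter-block edges, an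
Erdos-Renyi thinning of a complete multipartite graph with parameter q. It is of order qN by Cheeger's
inequality, since Chernoff bounds and a union bound over all vertex sets give edge expansion of order
qN and maximal degree at most 2qN. The hypotheses on the parameters enter only through
qN >> log N, and S and d_w concentrate around their means by Chernoff bounds.
*)

theory Submission
  imports Defs "HOL-Real_Asymp.Real_Asymp"
begin

subsection \<open>Expected hitting times of Markov chains\<close>

text \<open>Splitting off one step is what saves the constant. Pairing h with pi - delta_w directly
  means pairing with a function of squared norm of order 1, which gives only H_w = O(S / l) for a
  gap l that may be far below d_w. After one step the remaining function has squared norm O(1 /
  d_w), so the gap enters only through a correction of relative size 1 / sqrt l. The main term comes
  from Cauchy-Schwarz at the single vertex w, with constant 1, and matches the lower bound.

  Since the gap need not be sharp, intra-block edges may be discarded. Cheeger's inequality bounds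
  the gap by squared expansion over maximal degree. The expansion available between blocks is of
  order qN, while intra-block degrees, of order N p_m, could be much larger and spoil the quotient.
  On the inter-block graph both quantities are of order qN.

  The union bound over vertex sets is affordable because the failure probability for a set T is at
  most rho^|T|. The sum over all nonempty T is (1 + rho)^N - 1, small once N rho tends to 0, which
  is the scale qN >> log N.\<close>

lemma hitting_time_eq_suminf:
  "hitting_time w \<omega> = (\<Sum>n. of_bool (\<forall>k\<le>n. \<omega> k \<noteq> w) :: ennreal)"
proof (cases "\<exists>n. \<omega> n = w")
  case True
  define m where "m = (LEAST n. \<omega> n = w)"
  have m: "\<omega> m = w" and least: "\<And>k. \<omega> k = w \<Longrightarrow> m \<le> k"
    using True LeastI_ex[of "\<lambda>n. \<omega> n = w"] Least_le[of "\<lambda>n. \<omega> n = w"] unfolding m_def by auto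
  have "(\<forall>k\<le>n. \<omega> k \<noteq> w) \<longleftrightarrow> n < m" for n
    using m least by (metis leD leI le_trans)
  then have "(\<Sum>n. of_bool (\<forall>k\<le>n. \<omega> k \<noteq> w) :: ennreal) = (\<Sum>n. of_bool (n < m))"
    by simp
  also have "\<dots> = (\<Sum>n<m. of_bool (n < m))"
    by (rule suminf_finite) auto
  also have "\<dots> = of_nat m"
    by simp
  also have "\<dots> = hitting_time w \<omega>"
    unfolding hitting_time_def
    by (rule antisym) (auto intro!: INF_greatest INF_lower2[of m] simp: m least)
  finally show ?thesis ..
next
  case False
  have "(\<Sum>n. 1 :: ennreal) = top"
    using nn_integral_count_space_nat[of "\<lambda>_. 1"] by simp
  with False show ?thesis
    by (simp add: hitting_time_def)
qed

text \<open>The probability that the chain started in \<open>v\<close> avoids \<open>w\<close> at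
  all times up to \<open>n\<close>, in backward form: conditioning on the first step is what later
  produces the Laplace equation. The factor \<open>of_bool (v \<noteq> w)\<close> kills the chain at
  \<open>w\<close>.\<close>

primrec survival :: "('a \<Rightarrow> 'a pmf) \<Rightarrow> 'a \<Rightarrow> nat \<Rightarrow> 'a \<Rightarrow> ennreal" where
  "survival K w 0 v = of_bool (v \<noteq> w)"
| "survival K w (Suc n) v = of_bool (v \<noteq> w) * (\<integral>\<^sup>+u. survival K w n u \<partial>measure_pmf (K v))"

lemma survival_eq: "survival K w n v = of_bool (v \<noteq> w) * survival K w n v"
  by (cases n) auto

lemma survival_target [simp]: "survival K w n w = 0"
  by (cases n) auto

lemma survival_le_1: "survival K w n v \<le> 1"
proof (induction n arbitrary: v)
  case (Suc n)
  have "(\<integral>\<^sup>+u. survival K w n u \<partial>measure_pmf (K v)) \<le> (\<integral>\<^sup>+u. 1 \<partial>measure_pmf (K v))"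
    by (intro nn_integral_mono Suc)
  then show ?case by simp
qed simp

lemma nn_integral_markov_law:
  fixes K :: "'a \<Rightarrow> 'a pmf"
  assumes f: "f \<in> borel_measurable (PiM {0..<n} (\<lambda>_. count_space UNIV))"
  shows "(\<integral>\<^sup>+\<omega>. f (restrict \<omega> {0..<n}) \<partial>markov_law K v) =
    (\<integral>\<^sup>+\<omega>. f \<omega> \<partial>Ionescu_Tulcea.C (markov_kernel K v) (\<lambda>_. count_space UNIV) 0 n (\<lambda>_. undefined))"
proof -
  interpret Ionescu_Tulcea "markov_kernel K v" "\<lambda>_. count_space UNIV"
    by (rule Ionescu_Tulcea_markov_kernel)
  \<comment> \<open>\<open>up_to J\<close> is the least bound of the index set, so
    \<open>CI {0..<n}\<close> is \<open>C 0 n\<close> pushed through a restriction that changes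
    nothing.\<close>
  have u: "up_to {0..<n} = n"
    using up_to_iff[of "{0..<n}" n] up_to_less[of "{0..<n}" "n - 1"] by (cases n) auto
  have "(\<integral>\<^sup>+\<omega>. f (restrict \<omega> {0..<n}) \<partial>markov_law K v) =
      (\<integral>\<^sup>+\<omega>. f \<omega> \<partial>distr PF.lim (PiM {0..<n} (\<lambda>_. count_space UNIV)) (\<lambda>x. restrict x {0..<n}))"
    unfolding markov_law_def
    by (subst nn_integral_distr)
       (auto intro!: measurable_restrict simp: f measurable_cong_sets[OF PF.sets_lim refl])
  also have "\<dots> = (\<integral>\<^sup>+\<omega>. f \<omega> \<partial>CI {0..<n})"
    by (simp add: distr_lim)
  also have "\<dots> = (\<integral>\<^sup>+\<omega>. f \<omega> \<partial>C 0 n (\<lambda>_. undefined))"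
    unfolding CI_def u
    by (subst nn_integral_distr)
       (auto intro!: measurable_restrict nn_integral_cong simp: f space_C space_PiM sets_C
          measurable_cong_sets[OF sets_C refl] PiE_def extensional_restrict)
  finally show ?thesis .
qed

text \<open>The law is built by appending coordinates at the end, whereas \<open>survival\<close>
  conditions on the first step. The two meet through \<open>F n \<phi>\<close>, avoidance up to time
  \<open>n\<close> weighted by a function of the last position: integrating out the last coordinate
  applies the killed kernel once to \<open>\<phi>\<close> and lowers \<open>n\<close> by
  one.\<close>

lemma nn_integral_markov_law_avoid:
  fixes K :: "'a \<Rightarrow> 'a pmf"
  shows "(\<integral>\<^sup>+\<omega>. of_bool (\<forall>k\<le>n. \<omega> k \<noteq> w) \<partial>markov_law K v) = survival K w n v"
proof -
  let ?M = "\<lambda>_ :: nat. count_space (UNIV :: 'a set)"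
  interpret Ionescu_Tulcea "markov_kernel K v" ?M
    by (rule Ionescu_Tulcea_markov_kernel)
  let ?C = "\<lambda>n. C 0 n (\<lambda>_. undefined)"
  define F where "F n \<phi> \<omega> = (of_bool (\<forall>k\<le>n. \<omega> k \<noteq> w) * \<phi> (\<omega> n) :: ennreal)"
    for n and \<phi> :: "'a \<Rightarrow> ennreal" and \<omega> :: "nat \<Rightarrow> 'a"
  have F_meas [measurable]: "F n \<phi> \<in> borel_measurable (PiM {0..<Suc n} ?M)" for n \<phi>
  proof -
    have comp: "(\<lambda>\<omega>. g (\<omega> k)) \<in> borel_measurable (PiM {0..<Suc n} ?M)" if "k \<le> n" for k and g :: "'a \<Rightarrow> ennreal"
    proof (rule measurable_compose[where f = "\<lambda>\<omega>. \<omega> k" and g = g and N = "count_space UNIV"])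
      show "(\<lambda>\<omega>. \<omega> k) \<in> measurable (PiM {0..<Suc n} ?M) (count_space UNIV)"
        using that by (intro measurable_component_singleton) simp
    qed simp
    \<comment> \<open>As a product of functions of single coordinates, \<open>F n \<phi>\<close> is
      measurable factor by factor, whatever the state type.\<close>
    have "F n \<phi> = (\<lambda>\<omega>. (\<Prod>k\<le>n. of_bool (\<omega> k \<noteq> w)) * \<phi> (\<omega> n))"
    proof
      fix \<omega>
      have "(of_bool (\<forall>k\<le>n. \<omega> k \<noteq> w) :: ennreal) = (\<Prod>k\<le>n. of_bool (\<omega> k \<noteq> w))"
        by (cases "\<forall>k\<le>n. \<omega> k \<noteq> w") (auto intro!: prod_zero[symmetric])
      then show "F n \<phi> \<omega> = (\<Prod>k\<le>n. of_bool (\<omega> k \<noteq> w)) * \<phi> (\<omega> n)"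
        by (simp add: F_def)
    qed
    also have "\<dots> \<in> borel_measurable (PiM {0..<Suc n} ?M)"
      by (intro borel_measurable_times_ennreal borel_measurable_prod_ennreal comp) simp_all
    finally show ?thesis .
  qed
  have undef: "(\<lambda>_. undefined) \<in> space (PiM {0..<0} ?M)"
    by (simp add: space_PiM)
  have bind: "(\<integral>\<^sup>+\<omega>. f \<omega> \<partial>?C (Suc n)) = (\<integral>\<^sup>+\<omega>. (\<integral>\<^sup>+x. f (fun_upd \<omega> n x) \<partial>markov_kernel K v n \<omega>) \<partial>?C n)"
    if f [measurable]: "f \<in> borel_measurable (PiM {0..<Suc n} ?M)" for f n
  proof -
    have "(\<integral>\<^sup>+\<omega>. f \<omega> \<partial>?C (Suc n)) = (\<integral>\<^sup>+\<omega>. (\<integral>\<^sup>+\<omega>'. f \<omega>' \<partial>eP n \<omega>) \<partial>?C n)"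
      using measurable_eP[of n] measurable_cong_sets[OF sets_C[OF undef, of n] refl, of "subprob_algebra (PiM {0..<Suc n} ?M)"]
      by (simp) (subst nn_integral_bind[where B="PiM {0..<Suc n} ?M"], auto simp: space_C undef)
    also have "\<dots> = (\<integral>\<^sup>+\<omega>. (\<integral>\<^sup>+x. f (fun_upd \<omega> n x) \<partial>markov_kernel K v n \<omega>) \<partial>?C n)"
      by (intro nn_integral_cong nn_integral_eP) (auto simp: space_C[OF undef])
    finally show ?thesis .
  qed
  have F0: "(\<integral>\<^sup>+\<omega>. F 0 \<phi> \<omega> \<partial>?C 1) = of_bool (v \<noteq> w) * \<phi> v" for \<phi>
  proof -
    have "(\<integral>\<^sup>+\<omega>. F 0 \<phi> \<omega> \<partial>?C (Suc 0)) =
        (\<integral>\<^sup>+\<omega>. (\<integral>\<^sup>+x. F 0 \<phi> (fun_upd \<omega> 0 x) \<partial>markov_kernel K v 0 \<omega>) \<partial>?C 0)"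
      by (rule bind) (rule F_meas)
    also have "\<dots> = (\<integral>\<^sup>+\<omega>. of_bool (v \<noteq> w) * \<phi> v \<partial>return (PiM {0..<0} ?M) (\<lambda>_. undefined))"
      by (simp add: F_def markov_kernel_def)
    also have "\<dots> = of_bool (v \<noteq> w) * \<phi> v"
      by (rule nn_integral_return[OF undef]) simp
    finally show ?thesis by (simp del: C.simps)
  qed
  have FSuc: "(\<integral>\<^sup>+\<omega>. F (Suc n) \<phi> \<omega> \<partial>?C (Suc (Suc n))) =
      (\<integral>\<^sup>+\<omega>. F n (\<lambda>v. \<integral>\<^sup>+u. of_bool (u \<noteq> w) * \<phi> u \<partial>K v) \<omega> \<partial>?C (Suc n))" for n \<phi>
  proof -
    have *: "F (Suc n) \<phi> (fun_upd \<omega> (Suc n) x) = of_bool (\<forall>k\<le>n. \<omega> k \<noteq> w) * (of_bool (x \<noteq> w) * \<phi> x)" for \<omega> x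
    proof -
      have "(\<forall>k\<le>Suc n. (fun_upd \<omega> (Suc n) x) k \<noteq> w) \<longleftrightarrow> (\<forall>k\<le>n. \<omega> k \<noteq> w) \<and> x \<noteq> w"
        by (auto simp: le_Suc_eq)
      then show ?thesis by (simp add: F_def of_bool_conj mult.assoc)
    qed
    show ?thesis
      by (rule trans[OF bind[OF F_meas]], unfold *, intro nn_integral_cong)
         (simp add: F_def markov_kernel_def nn_integral_cmult)
  qed
  have Fcong: "F n (\<lambda>v. of_bool (v \<noteq> w) * \<phi> v) = F n \<phi>" for n \<phi>
    by (auto simp: F_def fun_eq_iff)
  \<comment> \<open>The total \<open>m + n\<close> is preserved: each induction step moves one unit
    of time from the trajectory into \<open>survival\<close>, hence the arbitrary
    \<open>m\<close>.\<close>
  have *: "(\<integral>\<^sup>+\<omega>. F n (survival K w m) \<omega> \<partial>?C (Suc n)) = survival K w (m + n) v" for m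
  proof (induction n arbitrary: m)
    case 0
    then show ?case using F0[of "survival K w m"] by (simp add: survival_eq[symmetric] del: C.simps)
  next
    case (Suc n)
    have "(\<integral>\<^sup>+\<omega>. F (Suc n) (survival K w m) \<omega> \<partial>?C (Suc (Suc n))) =
        (\<integral>\<^sup>+\<omega>. F n (survival K w (Suc m)) \<omega> \<partial>?C (Suc n))"
    proof -
      have "survival K w (Suc m) = (\<lambda>v. of_bool (v \<noteq> w) * (\<integral>\<^sup>+u. survival K w m u \<partial>K v))"
        by (simp add: fun_eq_iff)
      then have "F n (survival K w (Suc m)) = F n (\<lambda>v. \<integral>\<^sup>+u. survival K w m u \<partial>K v)"
        by (simp only: Fcong)
      then show ?thesis
        unfolding FSuc survival_eq[symmetric] by (simp only:)
    qed
    then show ?case using Suc[of "Suc m"] by (simp del: C.simps)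
  qed
  have "(\<integral>\<^sup>+\<omega>. of_bool (\<forall>k\<le>n. \<omega> k \<noteq> w) \<partial>markov_law K v) =
      (\<integral>\<^sup>+\<omega>. F n (\<lambda>_. 1) (restrict \<omega> {0..<Suc n}) \<partial>markov_law K v)"
    by (auto simp: F_def intro!: nn_integral_cong)
  also have "\<dots> = (\<integral>\<^sup>+\<omega>. F n (\<lambda>_. 1) \<omega> \<partial>?C (Suc n))"
    by (rule nn_integral_markov_law) simp
  also have "\<dots> = (\<integral>\<^sup>+\<omega>. F n (survival K w 0) \<omega> \<partial>?C (Suc n))"
  proof -
    have "F n (survival K w 0) = F n (\<lambda>_. 1)"
      by (auto simp: F_def fun_eq_iff)
    then show ?thesis by (simp only:)
  qed
  also have "\<dots> = survival K w n v"
    using *[of 0] by (simp only: add_0)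
  finally show ?thesis .
qed

text \<open>The tail-sum formula for an expectation. It holds in \<open>ennreal\<close>, so
  finiteness need not be known beforehand.\<close>

lemma nn_integral_hitting_time:
  fixes K :: "'a \<Rightarrow> 'a pmf"
  shows "(\<integral>\<^sup>+\<omega>. hitting_time w \<omega> \<partial>markov_law K v) = (\<Sum>n. survival K w n v)"
proof -
  interpret Ionescu_Tulcea "markov_kernel K v" "\<lambda>_ :: nat. count_space (UNIV :: 'a set)"
    by (rule Ionescu_Tulcea_markov_kernel)
  have "(\<lambda>\<omega>. of_bool (\<forall>k\<le>n. \<omega> k \<noteq> w) :: ennreal) \<in> borel_measurable (markov_law K v)" for n
  proof -
    have "(\<lambda>\<omega>. \<Prod>k\<le>n. of_bool (\<omega> k \<noteq> w) :: ennreal) \<in> borel_measurable (PiM UNIV (\<lambda>_ :: nat. count_space (UNIV :: 'a set)))"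
      by (intro borel_measurable_prod_ennreal measurable_compose[OF measurable_component_singleton]) simp_all
    also have "(\<lambda>\<omega>. \<Prod>k\<le>n. of_bool (\<omega> k \<noteq> w) :: ennreal) = (\<lambda>\<omega>. of_bool (\<forall>k\<le>n. \<omega> k \<noteq> w))"
      by (rule ext, case_tac "\<forall>k\<le>n. \<omega> k \<noteq> w") (auto intro!: prod_zero)
    finally show ?thesis
      by (simp add: markov_law_def measurable_cong_sets[OF PF.sets_lim refl])
  qed
  then show ?thesis
    unfolding hitting_time_eq_suminf
    by (simp only: nn_integral_suminf nn_integral_markov_law_avoid)
qed

subsection \<open>Dirichlet forms of weighted graphs\<close>

text \<open>The diagonal term vanishes, so a loop, although counted in the degree, has no effect
  here.\<close>

definition lap :: "('a \<Rightarrow> 'a \<Rightarrow> real) \<Rightarrow> 'a set \<Rightarrow> ('a \<Rightarrow> real) \<Rightarrow> 'a \<Rightarrow> real" where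
  "lap a V x v = (\<Sum>u\<in>V. a v u * (x v - x u))"

definition dirichlet :: "('a \<Rightarrow> 'a \<Rightarrow> real) \<Rightarrow> 'a set \<Rightarrow> ('a \<Rightarrow> real) \<Rightarrow> ('a \<Rightarrow> real) \<Rightarrow> real" where
  "dirichlet a V x y = (\<Sum>u\<in>V. \<Sum>v\<in>V. a u v * (x u - x v) * (y u - y v)) / 2"

text \<open>Summation by parts: exchanging \<open>u\<close> and \<open>v\<close> in the double sum
  and averaging the two forms replaces \<open>y u\<close> by half of
  \<open>y u - y v\<close>.\<close>

lemma sum_mult_lap:
  assumes sym: "\<And>u v. u \<in> V \<Longrightarrow> v \<in> V \<Longrightarrow> a u v = a v u"
  shows "(\<Sum>v\<in>V. y v * lap a V x v) = dirichlet a V x y"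
proof -
  have 1: "(\<Sum>v\<in>V. y v * lap a V x v) = (\<Sum>u\<in>V. \<Sum>v\<in>V. a u v * (x u - x v) * y u)"
    by (simp add: lap_def sum_distrib_left mult_ac)
  have "(\<Sum>u\<in>V. \<Sum>v\<in>V. a u v * (x u - x v) * y u) = (\<Sum>v\<in>V. \<Sum>u\<in>V. a u v * (x u - x v) * y u)"
    by (rule sum.swap)
  also have "\<dots> = - (\<Sum>u\<in>V. \<Sum>v\<in>V. a u v * (x u - x v) * y v)"
    unfolding sum_negf[symmetric] by (intro sum.cong refl) (simp add: sym algebra_simps)
  finally have "2 * (\<Sum>v\<in>V. y v * lap a V x v) =
      (\<Sum>u\<in>V. \<Sum>v\<in>V. a u v * (x u - x v) * y u) - (\<Sum>u\<in>V. \<Sum>v\<in>V. a u v * (x u - x v) * y v)"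
    using 1 by simp
  also have "\<dots> = 2 * dirichlet a V x y"
    by (simp add: dirichlet_def sum_subtractf[symmetric] right_diff_distrib)
  finally show ?thesis by simp
qed

lemma dirichlet_nonneg:
  assumes "\<And>u v. u \<in> V \<Longrightarrow> v \<in> V \<Longrightarrow> 0 \<le> a u v"
  shows "0 \<le> dirichlet a V x x"
  unfolding dirichlet_def using assms by (auto intro!: sum_nonneg simp: mult.assoc)

text \<open>Rayleigh monotonicity: a Poincare inequality for a subgraph passes to the whole
  graph.\<close>

lemma dirichlet_mono:
  assumes "\<And>u v. u \<in> V \<Longrightarrow> v \<in> V \<Longrightarrow> b u v \<le> a u v"
  shows "dirichlet b V x x \<le> dirichlet a V x x"
  unfolding dirichlet_def using assms
  by (auto intro!: sum_mono divide_right_mono mult_right_mono simp: mult.assoc)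

lemma weighted_Cauchy_Schwarz:
  fixes f g c :: "'a \<Rightarrow> real"
  assumes "\<And>i. i \<in> I \<Longrightarrow> 0 \<le> c i"
  shows "(\<Sum>i\<in>I. c i * f i * g i)\<^sup>2 \<le> (\<Sum>i\<in>I. c i * (f i)\<^sup>2) * (\<Sum>i\<in>I. c i * (g i)\<^sup>2)"
proof -
  have "(\<Sum>i\<in>I. c i * f i * g i) = (\<Sum>i\<in>I. (sqrt (c i) * f i) * (sqrt (c i) * g i))"
    using assms by (intro sum.cong refl) (simp add: algebra_simps flip: power2_eq_square)
  also have "\<dots>\<^sup>2 \<le> (\<Sum>i\<in>I. (sqrt (c i) * f i)\<^sup>2) * (\<Sum>i\<in>I. (sqrt (c i) * g i)\<^sup>2)"
    by (rule Cauchy_Schwarz_ineq_sum)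
  also have "\<dots> = (\<Sum>i\<in>I. c i * (f i)\<^sup>2) * (\<Sum>i\<in>I. c i * (g i)\<^sup>2)"
    using assms by (intro arg_cong2[of _ _ _ _ "(*)"] sum.cong refl) (simp_all add: power_mult_distrib)
  finally show ?thesis .
qed

lemma weighted_Cauchy_Schwarz2:
  fixes f g c :: "'a \<Rightarrow> 'a \<Rightarrow> real"
  assumes "\<And>u v. u \<in> V \<Longrightarrow> v \<in> V \<Longrightarrow> 0 \<le> c u v"
  shows "(\<Sum>u\<in>V. \<Sum>v\<in>V. c u v * f u v * g u v)\<^sup>2 \<le>
    (\<Sum>u\<in>V. \<Sum>v\<in>V. c u v * (f u v)\<^sup>2) * (\<Sum>u\<in>V. \<Sum>v\<in>V. c u v * (g u v)\<^sup>2)"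
  using weighted_Cauchy_Schwarz[of "V \<times> V" "case_prod c" "case_prod f" "case_prod g"] assms
  by (auto simp: sum.cartesian_product case_prod_unfold)

lemma dirichlet_Cauchy_Schwarz:
  assumes "\<And>u v. u \<in> V \<Longrightarrow> v \<in> V \<Longrightarrow> 0 \<le> a u v"
  shows "(dirichlet a V x y)\<^sup>2 \<le> dirichlet a V x x * dirichlet a V y y"
proof -
  have "(\<Sum>u\<in>V. \<Sum>v\<in>V. a u v * (x u - x v) * (y u - y v))\<^sup>2 \<le>
      (\<Sum>u\<in>V. \<Sum>v\<in>V. a u v * (x u - x v)\<^sup>2) * (\<Sum>u\<in>V. \<Sum>v\<in>V. a u v * (y u - y v)\<^sup>2)"
    using assms by (rule weighted_Cauchy_Schwarz2)
  then show ?thesis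
    by (simp add: dirichlet_def power_divide power2_eq_square mult.assoc)
qed

text \<open>Only an inequality, since a loop at \<open>w\<close> contributes to the row sum but not
  to the energy.\<close>

lemma dirichlet_of_bool_le:
  assumes "finite V" "w \<in> V"
    and sym: "\<And>u v. u \<in> V \<Longrightarrow> v \<in> V \<Longrightarrow> a u v = a v u"
    and nonneg: "\<And>u v. u \<in> V \<Longrightarrow> v \<in> V \<Longrightarrow> 0 \<le> a u v"
  shows "dirichlet a V (\<lambda>v. of_bool (v = w)) (\<lambda>v. of_bool (v = w)) \<le> (\<Sum>v\<in>V. a w v)"
proof -
  have "dirichlet a V (\<lambda>v. of_bool (v = w)) (\<lambda>v. of_bool (v = w)) = lap a V (\<lambda>v. of_bool (v = w)) w"
    using assms by (subst sum_mult_lap[OF sym, symmetric]) simp_all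
  also have "\<dots> \<le> (\<Sum>v\<in>V. a w v)"
    unfolding lap_def using assms by (intro sum_mono) auto
  finally show ?thesis .
qed

text \<open>The Laplacian at \<open>w\<close> is the pairing of \<open>g\<close> with the indicator
  of \<open>w\<close>, to which Cauchy-Schwarz for the Dirichlet form applies.\<close>

lemma lap_le_sqrt_dirichlet:
  assumes "finite V" "w \<in> V"
    and sym: "\<And>u v. u \<in> V \<Longrightarrow> v \<in> V \<Longrightarrow> a u v = a v u"
    and nonneg: "\<And>u v. u \<in> V \<Longrightarrow> v \<in> V \<Longrightarrow> 0 \<le> a u v"
  shows "(lap a V g w)\<^sup>2 \<le> dirichlet a V g g * (\<Sum>v\<in>V. a w v)"
proof -
  let ?\<delta> = "\<lambda>v. of_bool (v = w) :: real"
  have "lap a V g w = dirichlet a V g ?\<delta>"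
    using assms by (subst sum_mult_lap[OF sym, symmetric]) simp_all
  then have "(lap a V g w)\<^sup>2 \<le> dirichlet a V g g * dirichlet a V ?\<delta> ?\<delta>"
    using dirichlet_Cauchy_Schwarz[OF nonneg] by simp
  also have "\<dots> \<le> dirichlet a V g g * (\<Sum>v\<in>V. a w v)"
    by (intro mult_left_mono dirichlet_of_bool_le dirichlet_nonneg assms)
  finally show ?thesis .
qed

subsection \<open>Poincare inequality from edge expansion\<close>

text \<open>A discrete co-area inequality. Slicing \<open>y\<close> into horizontal layers, a layer
  of height \<open>c\<close> over \<open>T\<close> contributes \<open>c * card T\<close> to the left
  sum and \<open>c\<close> times the cut of \<open>T\<close> to the right one. The expansion applies
  because every layer lies inside the support of \<open>y\<close>.\<close>

lemma coarea_le:
  fixes b :: "'a \<Rightarrow> 'a \<Rightarrow> real"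
  assumes fin: "finite V"
    and sym: "\<And>u v. u \<in> V \<Longrightarrow> v \<in> V \<Longrightarrow> b u v = b v u"
    and expand: "\<And>T. T \<subseteq> V \<Longrightarrow> T \<noteq> {} \<Longrightarrow> 2 * card T \<le> card V \<Longrightarrow>
      h * real (card T) \<le> (\<Sum>u\<in>T. \<Sum>v\<in>V - T. b u v)"
    and nonneg: "\<And>v. v \<in> V \<Longrightarrow> 0 \<le> y v"
    and supp: "2 * card {v\<in>V. 0 < y v} \<le> card V"
  shows "h * (\<Sum>v\<in>V. y v) \<le> (\<Sum>u\<in>V. \<Sum>v\<in>V. b u v * \<bar>y u - y v\<bar>) / 2"
  using nonneg supp
proof (induction "card {v\<in>V. 0 < y v}" arbitrary: y rule: less_induct)
  case (less y)
  define T where "T = {v\<in>V. 0 < y v}"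
  have TV: "T \<subseteq> V" and finT: "finite T"
    using fin by (auto simp: T_def)
  have zero: "y v = 0" if "v \<in> V" "v \<notin> T" for v
    using that less.prems(1)[of v] by (auto simp: T_def)
  show ?case
  proof (cases "T = {}")
    case True
    then have "y v = 0" if "v \<in> V" for v
      using zero that by blast
    then show ?thesis by simp
  next
    case False
    define c where "c = Min (y ` T)"
    have "c \<in> y ` T" and c_le: "\<And>v. v \<in> T \<Longrightarrow> c \<le> y v"
      using finT False by (auto simp: c_def)
    then obtain v0 where v0: "v0 \<in> T" "y v0 = c"
      by auto
    then have "c > 0" by (auto simp: T_def)
    \<comment> \<open>Removing the bottom layer keeps the values nonnegative and drops
      \<open>v0\<close> from the support, so the induction on the size of the support
      proceeds.\<close>
    define z where "z v = y v - c * of_bool (v \<in> T)" for v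
    have z_nonneg: "0 \<le> z v" if "v \<in> V" for v
      using that c_le zero by (cases "v \<in> T") (auto simp: z_def)
    have sub: "{v\<in>V. 0 < z v} \<subseteq> T - {v0}"
      using v0 zero by (auto simp: z_def T_def)
    have less_card: "card {v\<in>V. 0 < z v} < card T"
      using sub v0(1) finT by (metis card_Diff1_less card_mono finite_Diff order_le_less_trans)
    have IH: "h * (\<Sum>v\<in>V. z v) \<le> (\<Sum>u\<in>V. \<Sum>v\<in>V. b u v * \<bar>z u - z v\<bar>) / 2"
      using less_card less.prems(2) z_nonneg unfolding T_def[symmetric] by (intro less.hyps) (auto simp: T_def)
    have cut: "h * real (card T) \<le> (\<Sum>u\<in>T. \<Sum>v\<in>V - T. b u v)"
      using expand[OF TV False] less.prems(2) by (simp add: T_def)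
    have "(\<Sum>v\<in>V. y v) = (\<Sum>v\<in>V. z v) + c * real (card T)"
    proof -
      have "(\<Sum>v\<in>V. c * of_bool (v \<in> T)) = (\<Sum>v\<in>T. c)"
        using TV fin by (intro sum.mono_neutral_cong_right) auto
      then show ?thesis by (simp add: z_def sum_subtractf)
    qed
    moreover have "(\<Sum>u\<in>V. \<Sum>v\<in>V. b u v * \<bar>y u - y v\<bar>) =
        (\<Sum>u\<in>V. \<Sum>v\<in>V. b u v * \<bar>z u - z v\<bar>) + 2 * c * (\<Sum>u\<in>T. \<Sum>v\<in>V - T. b u v)"
    proof -
      \<comment> \<open>Between \<open>T\<close> and its complement the difference grows by exactly
        \<open>c\<close>, as \<open>y\<close> and \<open>z\<close> vanish off \<open>T\<close>;
        within \<open>T\<close> the shift cancels.\<close>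
      have pw: "\<bar>y u - y v\<bar> = \<bar>z u - z v\<bar> + c * of_bool (u \<in> T \<and> v \<notin> T) + c * of_bool (v \<in> T \<and> u \<notin> T)"
        if "u \<in> V" "v \<in> V" for u v
        using c_le[of u] c_le[of v] zero[OF that(1)] zero[OF that(2)] \<open>c > 0\<close>
        by (cases "u \<in> T"; cases "v \<in> T") (simp_all add: z_def)
      have one: "(\<Sum>u\<in>V. \<Sum>v\<in>V. b u v * (c * of_bool (u \<in> T \<and> v \<notin> T))) = c * (\<Sum>u\<in>T. \<Sum>v\<in>V - T. b u v)"
      proof -
        have "(\<Sum>u\<in>T. \<Sum>v\<in>V - T. b u v) = (\<Sum>u\<in>T. \<Sum>v\<in>V. b u v * of_bool (v \<notin> T))"
          using fin by (intro sum.cong refl sum.mono_neutral_cong_left) auto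
        also have "\<dots> = (\<Sum>u\<in>V. of_bool (u \<in> T) * (\<Sum>v\<in>V. b u v * of_bool (v \<notin> T)))"
          using TV fin by (intro sum.mono_neutral_cong_left) auto
        finally show ?thesis
          by (simp add: sum_distrib_left of_bool_conj mult_ac)
      qed
      have two: "(\<Sum>u\<in>V. \<Sum>v\<in>V. b u v * (c * of_bool (v \<in> T \<and> u \<notin> T))) = c * (\<Sum>u\<in>T. \<Sum>v\<in>V - T. b u v)"
        unfolding one[symmetric] by (subst sum.swap) (intro sum.cong refl, simp add: sym)
      have "(\<Sum>u\<in>V. \<Sum>v\<in>V. b u v * \<bar>y u - y v\<bar>) =
          (\<Sum>u\<in>V. \<Sum>v\<in>V. b u v * \<bar>z u - z v\<bar> + b u v * (c * of_bool (u \<in> T \<and> v \<notin> T))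
             + b u v * (c * of_bool (v \<in> T \<and> u \<notin> T)))"
        by (intro sum.cong refl) (simp add: pw distrib_left)
      then show ?thesis
        by (simp add: sum.distrib one two)
    qed
    moreover have "h * (c * real (card T)) \<le> c * (\<Sum>u\<in>T. \<Sum>v\<in>V - T. b u v)"
      using mult_left_mono[OF cut, of c] \<open>c > 0\<close> by (simp add: mult_ac)
    ultimately show ?thesis
      using IH by (simp add: distrib_left)
  qed
qed

text \<open>The hard half of Cheeger's inequality: the co-area inequality is applied to the squares
  of \<open>y\<close>, their differences are factored, and Cauchy-Schwarz separates the energy from
  a sum that is at most \<open>4 * D * Y\<close>. One factor \<open>Y\<close> then cancels.\<close>

lemma cheeger_nonneg:
  fixes b :: "'a \<Rightarrow> 'a \<Rightarrow> real"
  assumes fin: "finite V" and h: "0 \<le> h"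
    and sym: "\<And>u v. u \<in> V \<Longrightarrow> v \<in> V \<Longrightarrow> b u v = b v u"
    and b_nonneg: "\<And>u v. u \<in> V \<Longrightarrow> v \<in> V \<Longrightarrow> 0 \<le> b u v"
    and deg: "\<And>u. u \<in> V \<Longrightarrow> (\<Sum>v\<in>V. b u v) \<le> D"
    and expand: "\<And>T. T \<subseteq> V \<Longrightarrow> T \<noteq> {} \<Longrightarrow> 2 * card T \<le> card V \<Longrightarrow>
      h * real (card T) \<le> (\<Sum>u\<in>T. \<Sum>v\<in>V - T. b u v)"
    and nonneg: "\<And>v. v \<in> V \<Longrightarrow> 0 \<le> y v"
    and supp: "2 * card {v\<in>V. 0 < y v} \<le> card V"
  shows "h\<^sup>2 * (\<Sum>v\<in>V. (y v)\<^sup>2) \<le> 2 * D * dirichlet b V y y"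
proof -
  define Y where "Y = (\<Sum>v\<in>V. (y v)\<^sup>2)"
  have "Y \<ge> 0" unfolding Y_def by (intro sum_nonneg) auto
  have E_nonneg: "0 \<le> dirichlet b V y y"
    by (rule dirichlet_nonneg[OF b_nonneg])
  have "{v\<in>V. 0 < (y v)\<^sup>2} = {v\<in>V. 0 < y v}"
    using nonneg by (auto simp: less_le)
  then have "h * Y \<le> (\<Sum>u\<in>V. \<Sum>v\<in>V. b u v * \<bar>(y u)\<^sup>2 - (y v)\<^sup>2\<bar>) / 2"
    using supp unfolding Y_def by (intro coarea_le fin sym expand) auto
  also have "(\<Sum>u\<in>V. \<Sum>v\<in>V. b u v * \<bar>(y u)\<^sup>2 - (y v)\<^sup>2\<bar>) = (\<Sum>u\<in>V. \<Sum>v\<in>V. b u v * \<bar>y u - y v\<bar> * (y u + y v))"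
  proof (intro sum.cong refl)
    fix u v assume "u \<in> V" "v \<in> V"
    then have "0 \<le> y u" "0 \<le> y v" using nonneg by auto
    moreover have "(y u)\<^sup>2 - (y v)\<^sup>2 = (y u - y v) * (y u + y v)"
      by (simp add: power2_eq_square algebra_simps)
    ultimately show "b u v * \<bar>(y u)\<^sup>2 - (y v)\<^sup>2\<bar> = b u v * \<bar>y u - y v\<bar> * (y u + y v)"
      by (simp add: abs_mult)
  qed
  finally have "(h * Y)\<^sup>2 \<le> ((\<Sum>u\<in>V. \<Sum>v\<in>V. b u v * \<bar>y u - y v\<bar> * (y u + y v)) / 2)\<^sup>2"
    using \<open>Y \<ge> 0\<close> h by (intro power_mono) auto
  also have "\<dots> \<le> ((\<Sum>u\<in>V. \<Sum>v\<in>V. b u v * \<bar>y u - y v\<bar>\<^sup>2) * (\<Sum>u\<in>V. \<Sum>v\<in>V. b u v * (y u + y v)\<^sup>2)) / 4"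
    using weighted_Cauchy_Schwarz2[of V b "\<lambda>u v. \<bar>y u - y v\<bar>" "\<lambda>u v. y u + y v"] b_nonneg
    by (simp add: power_divide)
  also have "(\<Sum>u\<in>V. \<Sum>v\<in>V. b u v * \<bar>y u - y v\<bar>\<^sup>2) = 2 * dirichlet b V y y"
    by (simp add: dirichlet_def power2_eq_square mult.assoc)
  also have "(2 * dirichlet b V y y * (\<Sum>u\<in>V. \<Sum>v\<in>V. b u v * (y u + y v)\<^sup>2)) / 4 \<le>
      (2 * dirichlet b V y y * (4 * D * Y)) / 4"
  proof -
    have row: "(\<Sum>u\<in>V. \<Sum>v\<in>V. b u v * (y u)\<^sup>2) \<le> D * Y"
      unfolding Y_def sum_distrib_left sum_distrib_right[symmetric]
      using deg by (intro sum_mono mult_right_mono) auto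
    have col: "(\<Sum>u\<in>V. \<Sum>v\<in>V. b u v * (y v)\<^sup>2) = (\<Sum>u\<in>V. \<Sum>v\<in>V. b u v * (y u)\<^sup>2)"
      by (subst sum.swap) (intro sum.cong refl, simp add: sym)
    have "(\<Sum>u\<in>V. \<Sum>v\<in>V. b u v * (y u + y v)\<^sup>2) \<le> (\<Sum>u\<in>V. \<Sum>v\<in>V. 2 * (b u v * (y u)\<^sup>2) + 2 * (b u v * (y v)\<^sup>2))"
    proof (intro sum_mono)
      fix u v assume "u \<in> V" "v \<in> V"
      have "(y u + y v)\<^sup>2 \<le> 2 * (y u)\<^sup>2 + 2 * (y v)\<^sup>2"
        using zero_le_power2[of "y u - y v"] by (simp add: power2_eq_square algebra_simps)
      then show "b u v * (y u + y v)\<^sup>2 \<le> 2 * (b u v * (y u)\<^sup>2) + 2 * (b u v * (y v)\<^sup>2)"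
        using mult_left_mono[of "(y u + y v)\<^sup>2" "2 * (y u)\<^sup>2 + 2 * (y v)\<^sup>2" "b u v"] b_nonneg \<open>u \<in> V\<close> \<open>v \<in> V\<close>
        by (simp add: algebra_simps)
    qed
    also have "\<dots> \<le> 4 * D * Y"
      using row col by (simp add: sum.distrib sum_distrib_left[symmetric])
    finally show ?thesis
      using E_nonneg by (intro divide_right_mono mult_left_mono) auto
  qed
  finally have *: "h\<^sup>2 * Y * Y \<le> 2 * D * dirichlet b V y y * Y"
    by (simp add: power2_eq_square mult_ac)
  show ?thesis
  \<comment> \<open>Nothing can be cancelled if \<open>Y = 0\<close>, but then it suffices that the
    right-hand side is nonnegative.\<close>
  proof (cases "Y = 0")
    case True
    have "2 * D * dirichlet b V y y \<ge> 0"
    proof (cases "V = {}")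
      case True then show ?thesis by (simp add: dirichlet_def)
    next
      case False
      then obtain u where "u \<in> V" by auto
      then have "0 \<le> D" using deg[of u] b_nonneg[of u] by (meson order_trans sum_nonneg)
      then show ?thesis using E_nonneg by simp
    qed
    then show ?thesis using True unfolding Y_def by simp
  next
    case False
    then have "0 < Y" using \<open>Y \<ge> 0\<close> by simp
    with * show ?thesis unfolding Y_def[symmetric] by (rule mult_right_le_imp_le)
  qed
qed

text \<open>Take the smallest value with at most half of the points strictly above it. The next
  smaller value \<open>t\<close> violates this, so more than half of the points are not below
  \<open>c\<close>.\<close>

lemma ex_median:
  fixes x :: "'a \<Rightarrow> real"
  assumes fin: "finite V"
  shows "\<exists>c. 2 * card {v\<in>V. c < x v} \<le> card V \<and> 2 * card {v\<in>V. x v < c} \<le> card V"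
proof (cases "V = {}")
  case False
  define A where "A = {t \<in> x ` V. 2 * card {v\<in>V. t < x v} \<le> card V}"
  have finA: "finite A" using fin by (simp add: A_def)
  have "Max (x ` V) \<in> A"
  proof -
    have "x v \<le> Max (x ` V)" if "v \<in> V" for v
      using fin that by simp
    then have "{v\<in>V. Max (x ` V) < x v} = {}"
      by (auto simp only: not_less[symmetric])
    then have "2 * card {v\<in>V. Max (x ` V) < x v} \<le> card V"
      by (simp only: card.empty)
    moreover have "Max (x ` V) \<in> x ` V"
      using fin False by (intro Max_in) auto
    ultimately show ?thesis unfolding A_def by blast
  qed
  then have neA: "A \<noteq> {}" by auto
  define c where "c = Min A"
  have "c \<in> A" using finA neA by (simp add: c_def)
  then have upper: "2 * card {v\<in>V. c < x v} \<le> card V" by (simp add: A_def)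
  have "2 * card {v\<in>V. x v < c} \<le> card V"
  proof (cases "{v\<in>V. x v < c} = {}")
    case ne: False
    let ?L = "{v\<in>V. x v < c}"
    define t where "t = Max (x ` ?L)"
    have "t \<in> x ` ?L" unfolding t_def using fin ne by (intro Max_in) auto
    then have t: "t \<in> x ` V" "t < c" by auto
    have "t \<notin> A" using t(2) finA neA by (auto simp: c_def)
    then have "card V < 2 * card {v\<in>V. t < x v}" using t(1) by (simp add: A_def)
    moreover have "{v\<in>V. t < x v} = V - ?L"
    proof -
      have "x v \<le> t" if "v \<in> ?L" for v
        unfolding t_def using fin that by (intro Max_ge) auto
      then show ?thesis using t(2) by (auto simp: not_less) force
    qed
    moreover have "card (V - ?L) = card V - card ?L"
      using fin by (intro card_Diff_subset) auto
    ultimately have "card V < 2 * (card V - card ?L)" by (simp only:)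
    then show ?thesis by linarith
  next
    case True
    show ?thesis unfolding True by simp
  qed
  with upper show ?thesis by blast
qed simp

text \<open>Centring at a median makes the positive and the negative part of \<open>x - c\<close>
  live on at most half of the vertices each, where \<open>cheeger_nonneg\<close> applies. A median
  serves as well as the mean, because the inequality will be paired with a function of sum
  zero.\<close>

lemma poincare_of_expansion:
  fixes b :: "'a \<Rightarrow> 'a \<Rightarrow> real"
  assumes fin: "finite V" and h: "0 \<le> h"
    and sym: "\<And>u v. u \<in> V \<Longrightarrow> v \<in> V \<Longrightarrow> b u v = b v u"
    and b_nonneg: "\<And>u v. u \<in> V \<Longrightarrow> v \<in> V \<Longrightarrow> 0 \<le> b u v"
    and deg: "\<And>u. u \<in> V \<Longrightarrow> (\<Sum>v\<in>V. b u v) \<le> D"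
    and expand: "\<And>T. T \<subseteq> V \<Longrightarrow> T \<noteq> {} \<Longrightarrow> 2 * card T \<le> card V \<Longrightarrow>
      h * real (card T) \<le> (\<Sum>u\<in>T. \<Sum>v\<in>V - T. b u v)"
  shows "\<exists>c. h\<^sup>2 * (\<Sum>v\<in>V. (x v - c)\<^sup>2) \<le> 2 * D * dirichlet b V x x"
proof (cases "V = {}")
  case False
  then obtain u where "u \<in> V" by auto
  then have D: "0 \<le> D" using deg[of u] b_nonneg[of u] by (meson order_trans sum_nonneg)
  obtain c where c: "2 * card {v\<in>V. c < x v} \<le> card V" "2 * card {v\<in>V. x v < c} \<le> card V"
    using ex_median[OF fin] by blast
  define y where "y v = max (x v - c) 0" for v
  define z where "z v = max (c - x v) 0" for v
  have "{v\<in>V. 0 < y v} = {v\<in>V. c < x v}" "{v\<in>V. 0 < z v} = {v\<in>V. x v < c}"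
    by (auto simp: y_def z_def)
  with c have supp: "2 * card {v\<in>V. 0 < y v} \<le> card V" "2 * card {v\<in>V. 0 < z v} \<le> card V"
    by simp_all
  have "0 \<le> y v" "0 \<le> z v" for v
    by (simp_all add: y_def z_def)
  note y_nonneg = this
  have "h\<^sup>2 * (\<Sum>v\<in>V. (y v)\<^sup>2) \<le> 2 * D * dirichlet b V y y"
    by (rule cheeger_nonneg; (fact | rule y_nonneg))
  moreover have "h\<^sup>2 * (\<Sum>v\<in>V. (z v)\<^sup>2) \<le> 2 * D * dirichlet b V z z"
    by (rule cheeger_nonneg; (fact | rule y_nonneg))
  moreover have "(\<Sum>v\<in>V. (x v - c)\<^sup>2) = (\<Sum>v\<in>V. (y v)\<^sup>2) + (\<Sum>v\<in>V. (z v)\<^sup>2)"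
    unfolding sum.distrib[symmetric]
    by (intro sum.cong refl) (auto simp: y_def z_def max_def power2_eq_square algebra_simps)
  moreover have "dirichlet b V y y + dirichlet b V z z \<le> dirichlet b V x x"
  proof -
    \<comment> \<open>The two parts have disjoint supports, so the surviving cross terms
      \<open>y u * z v\<close> and \<open>y v * z u\<close> are nonnegative and only increase the
      energy of \<open>x\<close>.\<close>
    have pw: "(y u - y v) * (y u - y v) + (z u - z v) * (z u - z v) \<le> (x u - x v) * (x u - x v)" for u v
    proof -
      have "y u * z u = 0" "y v * z v = 0" by (auto simp: y_def z_def max_def)
      moreover have "0 \<le> y u * z v" "0 \<le> y v * z u" by (auto simp: y_def z_def)
      moreover have "x u - x v = (y u - y v) - (z u - z v)" by (auto simp: y_def z_def max_def)
      then have "(x u - x v) * (x u - x v) = (y u - y v) * (y u - y v) + (z u - z v) * (z u - z v)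
          - 2 * (y u * z u) - 2 * (y v * z v) + 2 * (y u * z v) + 2 * (y v * z u)"
        by (simp only:) (simp add: algebra_simps)
      ultimately show ?thesis by linarith
    qed
    show ?thesis
      unfolding dirichlet_def add_divide_distrib[symmetric] sum.distrib[symmetric]
      using mult_left_mono[OF pw b_nonneg]
      by (intro divide_right_mono sum_mono) (auto simp: mult.assoc distrib_left)
  qed
  then have "2 * D * dirichlet b V y y + 2 * D * dirichlet b V z z \<le> 2 * D * dirichlet b V x x"
    using mult_left_mono[of "dirichlet b V y y + dirichlet b V z z" "dirichlet b V x x" "2 * D"] D
    by (simp add: distrib_left)
  ultimately show ?thesis
    by (intro exI[of _ c]) (simp add: distrib_left)
qed (simp add: dirichlet_def)

subsection \<open>Stationary averages of hitting times\<close>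

text \<open>Let \<open>m\<close> be the average and \<open>En\<close> the energy. As
  \<open>g \<ge> 0\<close>, the inequality for the Laplacian gives \<open>En \<le> S * m\<close>;
  conversely \<open>m\<close> is at most \<open>sqrt (En / d w)\<close> times a factor that is near
  1 for a large gap. Together this is a quadratic inequality in which \<open>m\<close> bounds
  itself.\<close>

lemma stationary_average_le:
  fixes a :: "'a \<Rightarrow> 'a \<Rightarrow> real"
  assumes fin: "finite V" and w: "w \<in> V"
    and sym: "\<And>u v. u \<in> V \<Longrightarrow> v \<in> V \<Longrightarrow> a u v = a v u"
    and a01: "\<And>u v. u \<in> V \<Longrightarrow> v \<in> V \<Longrightarrow> a u v \<in> {0, 1}"
    and d: "\<And>v. v \<in> V \<Longrightarrow> d v = (\<Sum>u\<in>V. a v u)" and S: "S = (\<Sum>v\<in>V. d v)"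
    and dw: "0 < d w" and l: "0 < l"
    and poincare: "\<And>x. \<exists>c. l * (\<Sum>v\<in>V. (x v - c)\<^sup>2) \<le> dirichlet a V x x"
    and gw: "g w = 0" and g: "\<And>v. v \<in> V \<Longrightarrow> 0 \<le> g v"
    and lap: "\<And>v. v \<in> V \<Longrightarrow> v \<noteq> w \<Longrightarrow> lap a V g v \<le> d v"
  shows "(\<Sum>v\<in>V. d v / S * g v) \<le> S / d w * (1 + sqrt ((1 + d w * real (card V) / S) / l))\<^sup>2"
proof -
  define m where "m = (\<Sum>v\<in>V. d v / S * g v)"
  define En where "En = dirichlet a V g g"
  \<comment> \<open>The stationary distribution minus the law after one step from \<open>w\<close>.
    Its sum is zero, so any constant \<open>c\<close> may be subtracted from
    \<open>g\<close>.\<close>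
  define f where "f v = d v / S - a w v / d w" for v
  have nonneg: "\<And>u v. u \<in> V \<Longrightarrow> v \<in> V \<Longrightarrow> 0 \<le> a u v" and sq: "\<And>u v. u \<in> V \<Longrightarrow> v \<in> V \<Longrightarrow> (a u v)\<^sup>2 = a u v"
    using a01 by force+
  have d_nonneg: "0 \<le> d v" if "v \<in> V" for v
    using that nonneg d by (simp add: sum_nonneg)
  have "d w \<le> S" unfolding S using fin w d_nonneg by (intro member_le_sum) auto
  then have Spos: "0 < S" using dw by simp
  have d_le: "d v \<le> card V" if "v \<in> V" for v
  proof -
    have "d v \<le> (\<Sum>u\<in>V. 1)" unfolding d[OF that] using a01 that by (intro sum_mono) force
    then show ?thesis by simp
  qed
  have En_nonneg: "0 \<le> En" unfolding En_def by (rule dirichlet_nonneg[OF nonneg])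
  have m_nonneg: "0 \<le> m"
    unfolding m_def using g d_nonneg Spos by (auto intro!: sum_nonneg)
  have En_le: "En \<le> S * m"
  proof -
    have "En = (\<Sum>v\<in>V. g v * lap a V g v)"
      unfolding En_def using sym by (simp add: sum_mult_lap)
    also have "\<dots> \<le> (\<Sum>v\<in>V. g v * d v)"
    proof (intro sum_mono)
      fix v assume "v \<in> V"
      then show "g v * lap a V g v \<le> g v * d v"
        using lap[of v] g[of v] gw by (cases "v = w") (auto intro!: mult_left_mono)
    qed
    also have "\<dots> = S * m" unfolding m_def sum_distrib_left using Spos by (simp add: mult_ac)
    finally show ?thesis .
  qed
  have f_sum: "(\<Sum>v\<in>V. f v) = 0"
  proof -
    have "(\<Sum>v\<in>V. f v) = (\<Sum>v\<in>V. d v) / S - (\<Sum>v\<in>V. a w v) / d w"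
      by (simp add: f_def sum_subtractf sum_divide_distrib)
    then show ?thesis
      using Spos dw by (simp add: S[symmetric] d[OF w, symmetric])
  qed
  have f_sq: "(\<Sum>v\<in>V. (f v)\<^sup>2) \<le> (1 + d w * real (card V) / S) / d w"
  proof -
    \<comment> \<open>The mixed term has the favourable sign, and the squares become linear through
      \<open>d v \<le> card V\<close> and \<open>(a w v)\<^sup>2 = a w v\<close>.\<close>
    have "(\<Sum>v\<in>V. (f v)\<^sup>2) \<le> (\<Sum>v\<in>V. card V * d v / S\<^sup>2 + a w v / (d w)\<^sup>2)"
    proof (intro sum_mono)
      fix v assume v: "v \<in> V"
      have "(f v)\<^sup>2 = (d v / S)\<^sup>2 + (a w v / d w)\<^sup>2 - 2 * (d v / S * (a w v / d w))"
        by (simp add: f_def power2_eq_square algebra_simps)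
      also have "\<dots> \<le> (d v / S)\<^sup>2 + (a w v / d w)\<^sup>2"
        using d_nonneg[OF v] Spos dw nonneg[OF w v] by simp
      also have "(a w v / d w)\<^sup>2 = a w v / (d w)\<^sup>2"
        by (simp add: power_divide sq[OF w v])
      also have "(d v / S)\<^sup>2 \<le> card V * d v / S\<^sup>2"
        using d_le[OF v] d_nonneg[OF v] Spos
        by (auto simp: power_divide power2_eq_square intro!: divide_right_mono mult_right_mono)
      finally show "(f v)\<^sup>2 \<le> card V * d v / S\<^sup>2 + a w v / (d w)\<^sup>2" by simp
    qed
    also have "\<dots> = card V * S / S\<^sup>2 + d w / (d w)\<^sup>2"
      by (simp add: sum.distrib sum_divide_distrib[symmetric] sum_distrib_left[symmetric] S[symmetric] d[OF w, symmetric])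
    also have "\<dots> = (1 + d w * real (card V) / S) / d w"
      using Spos dw by (simp add: power2_eq_square field_simps)
    finally show ?thesis .
  qed
  \<comment> \<open>As \<open>g w = 0\<close>, the Laplacian at \<open>w\<close> is minus the sum of
    \<open>g\<close> over the neighbours, so the term split off is exactly the average of
    \<open>g\<close> after one step.\<close>
  have "m = (\<Sum>v\<in>V. f v * g v) - lap a V g w / d w"
  proof -
    have "lap a V g w / d w = - (\<Sum>v\<in>V. a w v / d w * g v)"
      by (simp add: lap_def gw sum_negf sum_divide_distrib)
    then show ?thesis
      by (simp add: m_def f_def left_diff_distrib sum_subtractf)
  qed
  also have "\<dots> \<le> sqrt (En / d w) * sqrt ((1 + d w * real (card V) / S) / l) + sqrt (En / d w)"
  proof -
    obtain c where c: "l * (\<Sum>v\<in>V. (g v - c)\<^sup>2) \<le> En"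
      unfolding En_def using poincare by blast
    have "(\<Sum>v\<in>V. f v * g v) = (\<Sum>v\<in>V. f v * (g v - c))"
      by (simp add: right_diff_distrib sum_subtractf sum_distrib_right[symmetric] f_sum)
    also have "\<dots> \<le> sqrt ((\<Sum>v\<in>V. (f v)\<^sup>2) * (\<Sum>v\<in>V. (g v - c)\<^sup>2))"
      by (rule real_le_rsqrt) (rule Cauchy_Schwarz_ineq_sum)
    also have "\<dots> \<le> sqrt ((1 + d w * real (card V) / S) / d w * (En / l))"
      using c l f_sq d_nonneg[OF w] Spos by (intro real_sqrt_le_mono mult_mono) (auto simp: field_simps sum_nonneg)
    also have "\<dots> = sqrt (En / d w) * sqrt ((1 + d w * real (card V) / S) / l)"
      by (simp add: real_sqrt_mult[symmetric] mult_ac)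
    finally have 1: "(\<Sum>v\<in>V. f v * g v) \<le> sqrt (En / d w) * sqrt ((1 + d w * real (card V) / S) / l)" .
    have "(lap a V g w)\<^sup>2 \<le> En * d w"
      using lap_le_sqrt_dirichlet[where g = g and a = a, OF fin w sym nonneg] d[OF w] by (simp add: En_def)
    then have "(- lap a V g w / d w)\<^sup>2 \<le> En / d w"
      using dw by (simp add: power_divide) (simp add: power2_eq_square field_simps)
    then have "- lap a V g w / d w \<le> sqrt (En / d w)"
      by (rule real_le_rsqrt)
    with 1 show ?thesis by simp
  qed
  finally have m_le: "m \<le> sqrt (En / d w) * (1 + sqrt ((1 + d w * real (card V) / S) / l))"
    by (simp add: distrib_left)
  define K where "K = 1 + sqrt ((1 + d w * real (card V) / S) / l)"
  have "m\<^sup>2 \<le> (sqrt (En / d w) * K)\<^sup>2"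
    using m_le m_nonneg unfolding K_def[symmetric] by (intro power_mono)
  also have "\<dots> = En / d w * K\<^sup>2" using En_nonneg dw by (simp add: power_mult_distrib)
  also have "\<dots> \<le> S * m / d w * K\<^sup>2"
    using En_le dw by (intro mult_right_mono divide_right_mono) auto
  finally have "m * m \<le> (S / d w * K\<^sup>2) * m" by (simp add: power2_eq_square mult_ac)
  have "m \<le> S / d w * K\<^sup>2"
  proof (cases "m = 0")
    case False
    with m_nonneg have "0 < m" by simp
    with \<open>m * m \<le> (S / d w * K\<^sup>2) * m\<close> show ?thesis by (rule mult_right_le_imp_le)
  qed (use Spos dw in simp)
  then show ?thesis unfolding m_def K_def .
qed

lemma stationary_average_ge:
  fixes a :: "'a \<Rightarrow> 'a \<Rightarrow> real"
  assumes fin: "finite V" and w: "w \<in> V"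
    and sym: "\<And>u v. u \<in> V \<Longrightarrow> v \<in> V \<Longrightarrow> a u v = a v u"
    and nonneg: "\<And>u v. u \<in> V \<Longrightarrow> v \<in> V \<Longrightarrow> 0 \<le> a u v"
    and d: "\<And>v. v \<in> V \<Longrightarrow> d v = (\<Sum>u\<in>V. a v u)" and S: "S = (\<Sum>v\<in>V. d v)"
    and dw: "0 < d w"
    and gw: "g w = 0"
    and lap: "\<And>v. v \<in> V \<Longrightarrow> v \<noteq> w \<Longrightarrow> lap a V g v = d v"
  shows "S / d w * (1 - d w / S)\<^sup>2 \<le> (\<Sum>v\<in>V. d v / S * g v)"
proof -
  have d_nonneg: "0 \<le> d v" if "v \<in> V" for v
    using that nonneg d by (simp add: sum_nonneg)
  have "d w \<le> S" unfolding S using fin w d_nonneg by (intro member_le_sum) auto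
  then have Spos: "0 < S" using dw by simp
  have "0 = (\<Sum>v\<in>V. lap a V g v)"
    using sum_mult_lap[of V a "\<lambda>_. 1" g] sym by (simp add: dirichlet_def)
  also have "\<dots> = lap a V g w + (\<Sum>v\<in>V - {w}. d v)"
    using fin w lap by (subst sum.remove[of _ w]) auto
  also have "(\<Sum>v\<in>V - {w}. d v) = S - d w"
    using fin w by (simp add: S sum_diff1)
  finally have lap_w: "lap a V g w = - (S - d w)" by simp
  have "(lap a V g w)\<^sup>2 \<le> dirichlet a V g g * d w"
    unfolding d[OF w] by (intro lap_le_sqrt_dirichlet fin w sym nonneg)
  then have "(S - d w)\<^sup>2 \<le> dirichlet a V g g * d w"
    unfolding lap_w power2_minus .
  also have "dirichlet a V g g = (\<Sum>v\<in>V. g v * lap a V g v)"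
    using sym by (simp add: sum_mult_lap)
  also have "\<dots> = (\<Sum>v\<in>V. g v * d v)"
    using lap gw by (intro sum.cong refl) (metis mult_eq_0_iff)
  also have "\<dots> = S * (\<Sum>v\<in>V. d v / S * g v)"
    unfolding sum_distrib_left using Spos by (simp add: mult_ac)
  finally have "(S - d w)\<^sup>2 / (S * d w) \<le> (\<Sum>v\<in>V. d v / S * g v)"
    using Spos dw by (simp add: field_simps)
  moreover have "(S - d w)\<^sup>2 / (S * d w) = S / d w * (1 - d w / S)\<^sup>2"
    using Spos dw by (simp add: field_simps power2_eq_square)
  ultimately show ?thesis by simp
qed

subsection \<open>Hitting times of the walk on a graph\<close>

lemma finite_vertices [simp]: "finite (vertices N)" and card_vertices [simp]: "card (vertices N) = N"
  by (simp_all add: vertices_def)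

lemma finite_vertex_pairs [simp]: "finite (vertex_pairs N)"
  by (rule finite_subset[of _ "Pow (vertices N)"]) (auto simp: vertex_pairs_def)

lemma doubleton_in_vertex_pairs [simp]:
  "{u, v} \<in> vertex_pairs N \<longleftrightarrow> u \<in> vertices N \<and> v \<in> vertices N"
  by (auto simp: vertex_pairs_def doubleton_eq_iff)

text \<open>Degrees and cuts are sums over ordered pairs, while independence holds over unordered
  ones. Grouping turns the multiplicity of an edge into a weight.\<close>

lemma sum_ordered_pairs:
  fixes f :: "nat set \<Rightarrow> real"
  assumes "J \<subseteq> vertices N \<times> vertices N"
  shows "(\<Sum>(u, v)\<in>J. f {u, v}) =
    (\<Sum>e\<in>vertex_pairs N. real (card {x\<in>J. {fst x, snd x} = e}) * f e)"
proof -
  have fin: "finite J" using assms by (rule finite_subset) simp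
  have "(\<Sum>(u, v)\<in>J. f {u, v}) = (\<Sum>x\<in>J. f {fst x, snd x})"
    by (simp add: case_prod_unfold)
  also have "\<dots> = (\<Sum>e\<in>vertex_pairs N. \<Sum>x\<in>{x\<in>J. {fst x, snd x} = e}. f {fst x, snd x})"
    using assms by (intro sum.group[symmetric] fin) auto
  also have "\<dots> = (\<Sum>e\<in>vertex_pairs N. real (card {x\<in>J. {fst x, snd x} = e}) * f e)"
    by (intro sum.cong refl) simp
  finally show ?thesis .
qed

lemma card_ordered_pairs_le_2:
  "card {x\<in>J. {fst x, snd x} = e} \<le> 2"
proof (cases "{x\<in>J. {fst x, snd x} = e} = {}")
  case False
  then obtain a b where "e = {a, b}" by auto
  then have "{x\<in>J. {fst x, snd x} = e} \<subseteq> {(a, b), (b, a)}"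
    by (auto simp: doubleton_eq_iff)
  then have "card {x\<in>J. {fst x, snd x} = e} \<le> card {(a, b), (b, a)}"
    by (intro card_mono) auto
  also have "\<dots> \<le> 2" by (simp add: card_insert_le_m1)
  finally show ?thesis .
qed (simp only: card.empty)

lemma handshake:
  assumes E: "E \<subseteq> vertex_pairs N"
  shows "(\<Sum>v\<in>vertices N. real (vdegree N E v)) = 2 * real (card E) - real (card (loops E))"
proof -
  let ?c = "\<lambda>e. card {x\<in>vertices N \<times> vertices N. {fst x, snd x} = e}"
  have finE: "finite E" using E by (rule finite_subset) simp
  have c: "real (?c e) = 2 - of_bool (is_singleton e)" if "e \<in> E" for e
  proof -
    obtain a b where e: "e = {a, b}" "a \<in> vertices N" "b \<in> vertices N"
      using \<open>e \<in> E\<close> E unfolding vertex_pairs_def by blast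
    \<comment> \<open>The two orderings coincide for a loop, which is the source of the correction
      by \<open>loops E\<close>.\<close>
    then have *: "{x\<in>vertices N \<times> vertices N. {fst x, snd x} = e} = {(a, b), (b, a)}"
      by (auto simp: doubleton_eq_iff)
    show ?thesis
      unfolding * by (cases "a = b") (auto simp: e(1) is_singleton_def doubleton_eq_iff)
  qed
  have "(\<Sum>v\<in>vertices N. real (vdegree N E v)) =
      (\<Sum>(u, v)\<in>vertices N \<times> vertices N. of_bool ({u, v} \<in> E))"
    by (simp only: vdegree_def adj_def of_nat_sum of_nat_of_bool sum.cartesian_product)
  also have "\<dots> = (\<Sum>e\<in>vertex_pairs N. real (?c e) * of_bool (e \<in> E))"
    by (rule sum_ordered_pairs) simp
  also have "\<dots> = (\<Sum>e\<in>E. real (?c e))"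
    using E by (intro sum.mono_neutral_cong_right) auto
  also have "\<dots> = (\<Sum>e\<in>E. 2 - of_bool (is_singleton e))"
    by (intro sum.cong refl c)
  also have "\<dots> = 2 * real (card E) - real (card (loops E))"
    using finE by (simp add: sum_subtractf loops_def Int_def)
  finally show ?thesis .
qed

lemma nn_integral_srw_step:
  assumes "vdegree N E v > 0"
  shows "(\<integral>\<^sup>+u. f u \<partial>measure_pmf (srw_step N E v)) =
    (\<Sum>u\<in>vertices N. of_nat (adj E v u) * f u) / of_nat (vdegree N E v)"
proof -
  let ?A = "{u \<in> vertices N. {v, u} \<in> E}"
  have card: "vdegree N E v = card ?A"
    by (simp add: vdegree_def adj_def Int_def)
  have ne: "?A \<noteq> {}"
  proof
    assume "?A = {}"
    then show False using assms by (simp only: card card.empty)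
  qed
  have "(\<integral>\<^sup>+u. f u \<partial>measure_pmf (srw_step N E v)) = sum f ?A / of_nat (card ?A)"
    unfolding srw_step_def using ne by (subst nn_integral_pmf_of_set) auto
  also have "sum f ?A = (\<Sum>u\<in>vertices N. of_nat (adj E v u) * f u)"
    by (intro sum.mono_neutral_cong_left) (auto simp: adj_def)
  finally show ?thesis by (simp only: card)
qed

lemma avg_hitting_time_bounds:
  fixes N :: nat and E :: "nat set set" and l :: real
  defines "d \<equiv> \<lambda>v. real (vdegree N E v)"
  defines "S \<equiv> \<Sum>v\<in>vertices N. d v"
  assumes E: "E \<subseteq> vertex_pairs N" and w: "w \<in> vertices N" and l: "0 < l"
    and deg: "\<And>v. v \<in> vertices N \<Longrightarrow> 0 < vdegree N E v"
    and poincare: "\<And>x. \<exists>c. l * (\<Sum>v\<in>vertices N. (x v - c)\<^sup>2)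
      \<le> dirichlet (\<lambda>u v. real (adj E u v)) (vertices N) x x"
  shows "S / d w * (1 - d w / S)\<^sup>2 \<le> enn2real (avg_hitting_time N E w)"
    and "enn2real (avg_hitting_time N E w) \<le> S / d w * (1 + sqrt ((1 + d w * real N / S) / l))\<^sup>2"
proof -
  let ?V = "vertices N"
  define a where "a u v = real (adj E u v)" for u v
  define K where "K = srw_step N E"
  define s where "s k v = enn2real (survival K w k v)" for k v
  \<comment> \<open>With T the hitting time of \<open>w\<close>, this is the expectation of min(T, n
    + 1) for the walk started in \<open>v\<close>.\<close>
  define g where "g n v = (\<Sum>k\<le>n. s k v)" for n v
  define Ub where "Ub = S / d w * (1 + sqrt ((1 + d w * real N / S) / l))\<^sup>2"
  have sym: "a u v = a v u" for u v by (simp add: a_def adj_def insert_commute)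
  have a01: "a u v \<in> {0, 1}" for u v by (simp add: a_def adj_def)
  have d_sum: "d v = (\<Sum>u\<in>?V. a v u)" for v by (simp add: d_def vdegree_def a_def)
  have d_pos: "0 < d v" if "v \<in> ?V" for v using deg[OF that] by (simp add: d_def)
  have S_pos: "0 < S" unfolding S_def using w d_pos by (intro sum_pos) auto
  have s_nonneg: "0 \<le> s k v" for k v by (simp add: s_def)
  have surv: "survival K w k v = ennreal (s k v)" for k v
    using survival_le_1[of K w k v] unfolding s_def
    by (metis ennreal_enn2real ennreal_one_less_top order_le_less_trans)
  have s_w: "s k w = 0" for k by (simp add: s_def)
  have s_0: "s 0 v = of_bool (v \<noteq> w)" for v by (simp add: s_def)
  have s_Suc: "s (Suc k) v = (\<Sum>u\<in>?V. a v u * s k u) / d v" if "v \<in> ?V" "v \<noteq> w" for k v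
  proof -
    have "survival K w (Suc k) v = (\<Sum>u\<in>?V. of_nat (adj E v u) * ennreal (s k u)) / of_nat (vdegree N E v)"
      using that by (simp add: surv[symmetric] K_def nn_integral_srw_step[OF deg[OF that(1)]])
    also have "\<dots> = (\<Sum>u\<in>?V. ennreal (a v u * s k u)) / ennreal (d v)"
      by (simp add: a_def d_def s_nonneg ennreal_mult ennreal_of_nat_eq_real_of_nat)
    also have "\<dots> = ennreal ((\<Sum>u\<in>?V. a v u * s k u) / d v)"
      using d_pos[OF that(1)] s_nonneg by (simp add: a_def sum_nonneg divide_ennreal)
    finally show ?thesis
      using d_pos[OF that(1)] s_nonneg by (simp add: s_def a_def sum_nonneg)
  qed
  \<comment> \<open>First-step analysis for the truncation: the recursion for \<open>s\<close>
    shifts \<open>n\<close> by one, which leaves the nonpositive defect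
    \<open>d v * (g n v - g (Suc n) v)\<close>.\<close>
  have g_step: "lap a ?V (g n) v = d v + d v * (g n v - g (Suc n) v)" if "v \<in> ?V" "v \<noteq> w" for n v
  proof -
    have "d v * g (Suc n) v = d v * s 0 v + d v * (\<Sum>k\<le>n. s (Suc k) v)"
      unfolding g_def sum.atMost_Suc_shift by (simp add: distrib_left)
    also have "\<dots> = d v + (\<Sum>k\<le>n. \<Sum>u\<in>?V. a v u * s k u)"
      using d_pos[OF that(1)] that by (simp add: s_0 s_Suc sum_divide_distrib[symmetric])
    also have "\<dots> = d v + (\<Sum>u\<in>?V. a v u * g n u)"
      unfolding g_def by (subst sum.swap) (simp add: sum_distrib_left)
    finally have "d v * g (Suc n) v = d v + (\<Sum>u\<in>?V. a v u * g n u)" .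
    moreover have "lap a ?V (g n) v = d v * g n v - (\<Sum>u\<in>?V. a v u * g n u)"
      by (simp add: lap_def d_sum sum_distrib_right right_diff_distrib sum_subtractf)
    ultimately show ?thesis by (simp add: right_diff_distrib)
  qed
  have g_mono: "g n v \<le> g (Suc n) v" for n v
    by (simp add: g_def s_nonneg)
  have g_nonneg: "0 \<le> g n v" for n v
    unfolding g_def by (intro sum_nonneg s_nonneg)
  have g_w: "g n w = 0" for n by (simp add: g_def s_w)
  \<comment> \<open>The truncated sums \<open>g n\<close> are only subsolutions, but the upper bound applies to them uniformly
    in \<open>n\<close>; this is what makes the expected hitting times finite.\<close>
  have avg_le: "(\<Sum>v\<in>?V. d v / S * g n v) \<le> Ub" for n
    unfolding Ub_def
  proof (rule order_trans[OF stationary_average_le[where a = a and l = l]])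
    show "lap a ?V (g n) v \<le> d v" if "v \<in> ?V" "v \<noteq> w" for v
      unfolding g_step[OF that] using d_pos[OF that(1)] g_mono[of n v]
      by (simp add: mult_nonneg_nonpos)
    show "\<exists>c. l * (\<Sum>v\<in>?V. (x v - c)\<^sup>2) \<le> dirichlet a ?V x x" for x
      using poincare[of x] by (simp add: a_def[abs_def])
    show "d v = (\<Sum>u\<in>?V. a v u)" for v by (rule d_sum)
    show "S = (\<Sum>v\<in>?V. d v)" by (simp add: S_def)
    show "0 < d w" by (rule d_pos[OF w])
  qed (use w a01 sym l g_w g_nonneg in auto)
  \<comment> \<open>All weights \<open>d v / S\<close> are positive, so the uniform bound on the
    average bounds every starting vertex separately. The expected hitting times are thus finite, and
    \<open>enn2real\<close> does not fall back to its default 0.\<close>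
  have bounded: "g n v \<le> S * Ub / d v" if v: "v \<in> ?V" for n v
  proof -
    have "d v / S * g n v \<le> (\<Sum>v\<in>?V. d v / S * g n v)"
      using v d_pos S_pos g_nonneg by (intro member_le_sum mult_nonneg_nonneg divide_nonneg_nonneg) (auto simp: less_imp_le)
    also have "\<dots> \<le> Ub" by (rule avg_le)
    finally show ?thesis using d_pos[OF v] S_pos by (simp add: field_simps)
  qed
  have summable: "summable (\<lambda>k. s k v)" if v: "v \<in> ?V" for v
  proof (rule bounded_imp_summable[where B = "S * Ub / d v"])
    show "sum (\<lambda>k. s k v) {..n} \<le> S * Ub / d v" for n
      using bounded[OF v, of n] by (simp add: g_def)
  qed (rule s_nonneg)
  define G where "G v = (\<Sum>k. s k v)" for v
  have lim: "(\<lambda>n. g n v) \<longlonglongrightarrow> G v" if "v \<in> ?V" for v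
    using summable_LIMSEQ'[OF summable[OF that]] by (simp add: g_def G_def)
  have hit: "exp_hitting_time N E v w = ennreal (G v)" if v: "v \<in> ?V" for v
    unfolding exp_hitting_time_def K_def[symmetric] nn_integral_hitting_time surv G_def
    by (intro suminf_ennreal2 s_nonneg summable v)
  have G_nonneg: "0 \<le> G v" if "v \<in> ?V" for v
    unfolding G_def by (intro suminf_nonneg summable that s_nonneg)
  have avg: "enn2real (avg_hitting_time N E w) = (\<Sum>v\<in>?V. d v / S * G v)"
  proof -
    have "avg_hitting_time N E w = (\<Sum>v\<in>?V. ennreal (d v / S * G v))"
      unfolding avg_hitting_time_def
    proof (intro sum.cong refl)
      fix v assume v: "v \<in> ?V"
      show "ennreal (invariant_dist N E v) * exp_hitting_time N E v w = ennreal (d v / S * G v)"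
      proof -
        have "invariant_dist N E v = d v / S"
          by (simp add: invariant_dist_def handshake[OF E, symmetric] d_def S_def)
        then show ?thesis
          using d_pos[OF v] S_pos G_nonneg[OF v]
          by (simp only: hit[OF v]) (simp add: ennreal_mult[symmetric] less_imp_le)
      qed
    qed
    also have "\<dots> = ennreal (\<Sum>v\<in>?V. d v / S * G v)"
      using d_pos S_pos G_nonneg by (intro sum_ennreal mult_nonneg_nonneg) (auto intro: less_imp_le)
    finally show ?thesis
      using d_pos S_pos G_nonneg by (simp add: sum_nonneg less_imp_le)
  qed
  have "(\<lambda>n. \<Sum>v\<in>?V. d v / S * g n v) \<longlonglongrightarrow> (\<Sum>v\<in>?V. d v / S * G v)"
    by (intro tendsto_intros lim)
  then show "enn2real (avg_hitting_time N E w) \<le> S / d w * (1 + sqrt ((1 + d w * real N / S) / l))\<^sup>2"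
    unfolding avg Ub_def[symmetric] by (rule LIMSEQ_le_const2) (use avg_le in blast)
  \<comment> \<open>In the limit the defect disappears; the lower bound uses the equation itself,
    not just the inequality.\<close>
  have lapG: "lap a ?V G v = d v" if v: "v \<in> ?V" "v \<noteq> w" for v
  proof (rule LIMSEQ_unique)
    show "(\<lambda>n. lap a ?V (g n) v) \<longlonglongrightarrow> lap a ?V G v"
      unfolding lap_def by (intro tendsto_intros lim v)
    have "(\<lambda>n. d v + d v * (g n v - g (Suc n) v)) \<longlonglongrightarrow> d v + d v * (G v - G v)"
      by (intro tendsto_intros lim v LIMSEQ_Suc[OF lim])
    then show "(\<lambda>n. lap a ?V (g n) v) \<longlonglongrightarrow> d v"
      by (simp add: g_step[OF v])
  qed
  show "S / d w * (1 - d w / S)\<^sup>2 \<le> enn2real (avg_hitting_time N E w)"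
    unfolding avg
  proof (rule stationary_average_ge[where a = a])
    show "G w = 0" by (simp add: G_def s_w)
    show "lap a ?V G v = d v" if "v \<in> ?V" "v \<noteq> w" for v
      using that by (rule lapG)
    show "d v = (\<Sum>u\<in>?V. a v u)" for v by (rule d_sum)
    show "S = (\<Sum>v\<in>?V. d v)" by (simp add: S_def)
    show "0 < d w" by (rule d_pos[OF w])
    show "0 \<le> a u v" for u v by (simp add: a_def)
  qed (use w sym in auto)
qed

section \<open>Consequences of edge expansion: connectivity and hitting times\<close>

lemma graph_connected_of_expansion:
  assumes h: "0 < h"
    and b_le: "\<And>u v. u \<in> vertices N \<Longrightarrow> v \<in> vertices N \<Longrightarrow> b u v \<le> real (adj E u v)"
    and expand: "\<And>T. T \<subseteq> vertices N \<Longrightarrow> T \<noteq> {} \<Longrightarrow> 2 * card T \<le> N \<Longrightarrow>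
      h * real (card T) \<le> (\<Sum>u\<in>T. \<Sum>v\<in>vertices N - T. b u v)"
  shows "graph_connected N E"
  unfolding graph_connected_def
proof (intro ballI, rule ccontr)
  let ?V = "vertices N" and ?R = "{(x, y). x \<in> vertices N \<and> y \<in> vertices N \<and> {x, y} \<in> E}"
  fix v w assume v: "v \<in> ?V" and w: "w \<in> ?V" and "(v, w) \<notin> ?R\<^sup>*"
  \<comment> \<open>The set reachable from \<open>v\<close>: no edge joins it to its complement, and
    one of the two has at most half of the vertices, contradicting the expansion.\<close>
  define T where "T = {u\<in>?V. (v, u) \<in> ?R\<^sup>*}"
  have T: "T \<subseteq> ?V" "v \<in> T" "w \<in> ?V - T"
    using v w \<open>(v, w) \<notin> ?R\<^sup>*\<close> by (auto simp: T_def)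
  have no_edge: "{x, y} \<notin> E" if "x \<in> T" "y \<in> ?V - T" for x y
  proof
    assume "{x, y} \<in> E"
    then have "(x, y) \<in> ?R" using that T by auto
    moreover have "(v, x) \<in> ?R\<^sup>*" using that by (auto simp: T_def)
    ultimately have "(v, y) \<in> ?R\<^sup>*" by (rule rtrancl_into_rtrancl[rotated])
    with that show False by (auto simp: T_def)
  qed
  have absurd: False
    if U: "U \<subseteq> ?V" "U \<noteq> {}" "2 * card U \<le> N" and none: "\<And>x y. x \<in> U \<Longrightarrow> y \<in> ?V - U \<Longrightarrow> {x, y} \<notin> E" for U
  proof -
    have "finite U" using U(1) by (rule finite_subset) simp
    then have "0 < h * real (card U)" using h U by (simp add: card_gt_0_iff)
    also have "\<dots> \<le> (\<Sum>u\<in>U. \<Sum>v\<in>?V - U. b u v)" by (rule expand[OF U])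
    also have "\<dots> \<le> (\<Sum>u\<in>U. \<Sum>v\<in>?V - U. real (adj E u v))"
      using U by (intro sum_mono b_le) auto
    also have "\<dots> = 0" using none by (simp add: adj_def)
    finally show False by simp
  qed
  have "card (?V - T) = N - card T" "card T \<le> N"
    using T(1) card_mono[of ?V T] by (simp_all add: card_Diff_subset finite_subset)
  then consider "2 * card T \<le> N" | "2 * card (?V - T) \<le> N" by linarith
  then show False
  proof cases
    case 1
    show False by (rule absurd[OF T(1) _ 1 no_edge]) (use T in auto)
  next
    case 2
    show False
    proof (rule absurd[OF _ _ 2])
      show "{x, y} \<notin> E" if "x \<in> ?V - T" "y \<in> ?V - (?V - T)" for x y
        using that no_edge[of y x] by (auto simp: insert_commute)
    qed (use T in auto)
  qed
qed

text \<open>Expansion and the degree bound are required of a minorant \<open>b\<close> of the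
  adjacency matrix. Hence \<open>D\<close> may be far below the degrees of the graph itself, which
  enter only through \<open>d w\<close> and \<open>S\<close>.\<close>

lemma avg_hitting_time_of_expansion:
  fixes N :: nat and E :: "nat set set" and b :: "nat \<Rightarrow> nat \<Rightarrow> real"
  defines "d \<equiv> \<lambda>v. real (vdegree N E v)"
  defines "S \<equiv> \<Sum>v\<in>vertices N. d v"
  assumes E: "E \<subseteq> vertex_pairs N" and w: "w \<in> vertices N" and h: "0 < h" and N: "2 \<le> N"
    and sym: "\<And>u v. b u v = b v u" and b_nonneg: "\<And>u v. 0 \<le> b u v"
    and b_le: "\<And>u v. b u v \<le> real (adj E u v)"
    and D: "\<And>u. u \<in> vertices N \<Longrightarrow> (\<Sum>v\<in>vertices N. b u v) \<le> D"
    and expand: "\<And>T. T \<subseteq> vertices N \<Longrightarrow> T \<noteq> {} \<Longrightarrow> 2 * card T \<le> N \<Longrightarrow>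
      h * real (card T) \<le> (\<Sum>u\<in>T. \<Sum>v\<in>vertices N - T. b u v)"
  shows "S / d w * (1 - d w / S)\<^sup>2 \<le> enn2real (avg_hitting_time N E w)"
    and "enn2real (avg_hitting_time N E w) \<le> S / d w * (1 + sqrt ((1 + d w * real N / S) * (2 * D / h\<^sup>2)))\<^sup>2"
proof -
  let ?V = "vertices N"
  \<comment> \<open>Singletons are admissible cuts because \<open>2 \<le> N\<close>; this excludes
    isolated vertices.\<close>
  have row: "h \<le> (\<Sum>v\<in>?V. b u v)" if "u \<in> ?V" for u
  proof -
    have "h \<le> (\<Sum>v\<in>?V - {u}. b u v)" using expand[of "{u}"] that N by simp
    also have "\<dots> \<le> (\<Sum>v\<in>?V. b u v)" using b_nonneg by (intro sum_mono2) auto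
    finally show ?thesis .
  qed
  have Dpos: "0 < D" using row[OF w] D[OF w] h by linarith
  have deg: "0 < vdegree N E v" if "v \<in> ?V" for v
  proof -
    have "h \<le> (\<Sum>u\<in>?V. real (adj E v u))"
      using row[OF that] by (rule order_trans) (intro sum_mono b_le)
    then show ?thesis using h unfolding vdegree_def of_nat_sum[symmetric]
      by (metis gr0I linorder_not_less of_nat_0)
  qed
  define l where "l = h\<^sup>2 / (2 * D)"
  have l: "0 < l" using h Dpos by (simp add: l_def)
  have poincare: "\<exists>c. l * (\<Sum>v\<in>?V. (x v - c)\<^sup>2) \<le> dirichlet (\<lambda>u v. real (adj E u v)) ?V x x" for x
  proof -
    have "\<exists>c. h\<^sup>2 * (\<Sum>v\<in>?V. (x v - c)\<^sup>2) \<le> 2 * D * dirichlet b ?V x x"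
      by (rule poincare_of_expansion) (use h sym b_nonneg D expand in \<open>simp_all add: less_imp_le\<close>)
    then obtain c where "h\<^sup>2 * (\<Sum>v\<in>?V. (x v - c)\<^sup>2) \<le> 2 * D * dirichlet b ?V x x" by blast
    then have "l * (\<Sum>v\<in>?V. (x v - c)\<^sup>2) \<le> dirichlet b ?V x x"
      using Dpos by (simp add: l_def field_simps)
    also have "\<dots> \<le> dirichlet (\<lambda>u v. real (adj E u v)) ?V x x"
      by (intro dirichlet_mono b_le)
    finally show ?thesis by blast
  qed
  note bounds = avg_hitting_time_bounds[OF E w l deg poincare]
  show "S / d w * (1 - d w / S)\<^sup>2 \<le> enn2real (avg_hitting_time N E w)"
    using bounds(1) unfolding d_def S_def .
  show "enn2real (avg_hitting_time N E w) \<le> S / d w * (1 + sqrt ((1 + d w * real N / S) * (2 * D / h\<^sup>2)))\<^sup>2"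
    using bounds(2) unfolding d_def S_def l_def by simp
qed

text \<open>Here \<open>256 / x\<close> is the inverse of the gap bound, with \<open>x\<close>
  standing for qN, and the arguments of \<open>max\<close> are the relative errors from above and
  from below. The assumption \<open>dominated\<close> says that the mean degree of the target is at
  most \<open>M\<close> times the average mean degree.\<close>

lemma hitting_ratio_bound:
  fixes H S d S0 \<gamma> \<epsilon> x N M :: real
  assumes \<epsilon>: "0 < \<epsilon>" "\<epsilon> \<le> 1 / 2" and \<gamma>: "0 < \<gamma>" and S0: "0 < S0" and N: "0 < N" "3 * M \<le> N" and x: "0 < x"
    and dominated: "\<gamma> * N \<le> M * S0"
    and d: "\<bar>d - \<gamma>\<bar> \<le> \<epsilon> * \<gamma>" and S: "\<bar>S - S0\<bar> \<le> \<epsilon> * S0"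
    and lower: "S / d * (1 - d / S)\<^sup>2 \<le> H"
    and upper: "H \<le> S / d * (1 + sqrt ((1 + d * N / S) * (256 / x)))\<^sup>2"
  shows "\<bar>H / (S0 / \<gamma>) - 1\<bar> \<le>
    max ((1 + \<epsilon>) / (1 - \<epsilon>) * (1 + sqrt ((1 + 3 * M) * (256 / x)))\<^sup>2 - 1)
        (1 - (1 - \<epsilon>) / (1 + \<epsilon>) * (1 - 3 * M / N)\<^sup>2)"
proof -
  have dl: "(1 - \<epsilon>) * \<gamma> \<le> d" and du: "d \<le> (1 + \<epsilon>) * \<gamma>"
    using d unfolding abs_le_iff by (simp_all add: algebra_simps)
  have Sl: "(1 - \<epsilon>) * S0 \<le> S" and Su: "S \<le> (1 + \<epsilon>) * S0"
    using S unfolding abs_le_iff by (simp_all add: algebra_simps)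
  have "0 < (1 - \<epsilon>) * \<gamma>" "0 < (1 - \<epsilon>) * S0" using \<epsilon> \<gamma> S0 by simp_all
  then have dpos: "0 < d" and Spos: "0 < S" using dl Sl by linarith+
  have "S / d \<le> ((1 + \<epsilon>) * S0) / ((1 - \<epsilon>) * \<gamma>)"
    using dl Su \<epsilon> \<gamma> S0 by (intro frac_le) auto
  then have ratio_u: "S / d \<le> (1 + \<epsilon>) / (1 - \<epsilon>) * (S0 / \<gamma>)" by simp
  have "((1 - \<epsilon>) * S0) / ((1 + \<epsilon>) * \<gamma>) \<le> S / d"
    using du Sl \<epsilon> S0 dpos Spos by (intro frac_le) auto
  then have ratio_l: "(1 - \<epsilon>) / (1 + \<epsilon>) * (S0 / \<gamma>) \<le> S / d" by simp
  \<comment> \<open>As \<open>\<epsilon> \<le> 1 / 2\<close>, the degree is at most 3/2 and the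
    degree sum at least 1/2 of its mean, hence the factor 3.\<close>
  have dS: "d * N / S \<le> 3 * M"
  proof -
    have "(1 + \<epsilon>) * \<gamma> \<le> 3 / 2 * \<gamma>" "1 / 2 * S0 \<le> (1 - \<epsilon>) * S0"
      using \<epsilon> \<gamma> S0 by (intro mult_right_mono; simp)+
    then have "d \<le> 3 / 2 * \<gamma>" "1 / 2 * S0 \<le> S" using du Sl by linarith+
    then have "d * N \<le> 3 / 2 * \<gamma> * N"
      using N by (intro mult_right_mono) auto
    also have "\<dots> \<le> 3 / 2 * (M * S0)"
      using mult_left_mono[OF dominated, of "3 / 2"] by (simp only: mult.assoc)
    also have "\<dots> \<le> 3 * M * S"
    proof -
      have "0 \<le> M"
        using dominated \<gamma> N S0 by (metis mult_nonneg_nonneg less_imp_le order_trans zero_le_mult_iff not_less mult_pos_pos)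
      then have "3 * M * (1 / 2 * S0) \<le> 3 * M * S"
        using \<open>1 / 2 * S0 \<le> S\<close> by (intro mult_left_mono) auto
      then show ?thesis by simp
    qed
    finally show ?thesis using Spos by (simp add: divide_le_eq)
  qed
  then have dS': "d / S \<le> 3 * M / N"
    using N Spos by (simp add: field_simps)
  have dN: "0 \<le> d * N / S" using dpos N Spos by simp
  have T: "0 < S0 / \<gamma>" using S0 \<gamma> by simp
  have r0: "0 \<le> (1 + d * N / S) * (256 / x)"
    using dN x by (intro mult_nonneg_nonneg) auto
  have "(1 + d * N / S) * (256 / x) \<le> (1 + 3 * M) * (256 / x)"
    using dS x by (intro mult_right_mono) auto
  then have sq: "(1 + sqrt ((1 + d * N / S) * (256 / x)))\<^sup>2 \<le> (1 + sqrt ((1 + 3 * M) * (256 / x)))\<^sup>2"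
    using real_sqrt_ge_zero[OF r0] by (intro power_mono add_left_mono real_sqrt_le_mono) linarith+
  have "0 \<le> (1 + \<epsilon>) / (1 - \<epsilon>) * (S0 / \<gamma>)"
    using \<epsilon> T by (intro mult_nonneg_nonneg) auto
  with upper have "H \<le> (1 + \<epsilon>) / (1 - \<epsilon>) * (S0 / \<gamma>) * (1 + sqrt ((1 + 3 * M) * (256 / x)))\<^sup>2"
    by (elim order_trans) (rule mult_mono[OF ratio_u sq _ zero_le_power2])
  then have u: "H / (S0 / \<gamma>) \<le> (1 + \<epsilon>) / (1 - \<epsilon>) * (1 + sqrt ((1 + 3 * M) * (256 / x)))\<^sup>2"
    using T by (subst pos_divide_le_eq) (simp_all only: mult_ac)
  \<comment> \<open>This keeps \<open>1 - 3 * M / N\<close> nonnegative, so that squaring preserves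
    the order.\<close>
  have "3 * M / N \<le> 1" using N by simp
  then have "(1 - 3 * M / N)\<^sup>2 \<le> (1 - d / S)\<^sup>2"
    using dS' by (intro power_mono) auto
  then have "(1 - \<epsilon>) / (1 + \<epsilon>) * (S0 / \<gamma>) * (1 - 3 * M / N)\<^sup>2 \<le> S / d * (1 - d / S)\<^sup>2"
    using ratio_l dpos Spos \<epsilon> T by (intro mult_mono) auto
  also note lower
  finally have l: "(1 - \<epsilon>) / (1 + \<epsilon>) * (1 - 3 * M / N)\<^sup>2 \<le> H / (S0 / \<gamma>)"
    using T by (subst pos_le_divide_eq) (simp_all only: mult_ac)
  from u l show ?thesis by linarith
qed

subsection \<open>Concentration in the stochastic block model\<close>

lemma exp_le_quadratic:
  fixes x :: real
  assumes "\<bar>x\<bar> \<le> 1"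
  shows "exp x \<le> 1 + x + x\<^sup>2"
proof (cases "0 \<le> x")
  case True
  then show ?thesis using assms by (intro exp_bound) auto
next
  case False
  define y where "y = - x"
  have y: "0 < y" "y \<le> 1" using False assms by (auto simp: y_def)
  \<comment> \<open>The product equals \<open>1 + y ^ 3\<close>; the negative case then follows by
    taking reciprocals.\<close>
  have "1 \<le> (1 + y) * (1 - y + y\<^sup>2)"
    using y by (simp add: algebra_simps power2_eq_square)
  also have "\<dots> \<le> exp y * (1 - y + y\<^sup>2)"
    using y by (intro mult_right_mono exp_ge_add_one_self) (simp add: add_nonneg_nonneg)
  finally have "exp (- y) \<le> 1 - y + y\<^sup>2"
    by (simp add: exp_minus field_simps)
  then show ?thesis by (simp add: y_def)
qed

context
  fixes I :: "'i set" and r c :: "'i \<Rightarrow> real"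
  assumes fin: "finite I"
    and r: "\<And>e. e \<in> I \<Longrightarrow> r e \<in> {0..1}"
    and c: "\<And>e. e \<in> I \<Longrightarrow> c e \<in> {0..2}"
begin

text \<open>Weights up to 2 account for the two orientations of an edge. They explain the range of
  \<open>t\<close>, which ensures \<open>\<bar>t * c e\<bar> \<le> 1\<close>, and the bound
  \<open>(t * c e)\<^sup>2 \<le> 2 * t\<^sup>2 * c e\<close>, which makes the quadratic term a
  multiple of the mean.\<close>

lemma mgf_weighted_bernoulli_le:
  assumes t: "\<bar>t\<bar> \<le> 1 / 2"
  shows "measure_pmf.expectation (Pi_pmf I False (\<lambda>e. bernoulli_pmf (r e)))
      (\<lambda>\<epsilon>. exp (t * (\<Sum>e\<in>I. c e * of_bool (\<epsilon> e)))) \<le> exp ((t + 2 * t\<^sup>2) * (\<Sum>e\<in>I. c e * r e))"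
proof -
  let ?P = "Pi_pmf I False (\<lambda>e. bernoulli_pmf (r e))"
  have "measure_pmf.expectation ?P (\<lambda>\<epsilon>. exp (t * (\<Sum>e\<in>I. c e * of_bool (\<epsilon> e)))) =
      measure_pmf.expectation ?P (\<lambda>\<epsilon>. \<Prod>e\<in>I. exp (t * c e * of_bool (\<epsilon> e)))"
    by (simp add: sum_distrib_left exp_sum[OF fin] mult.assoc)
  also have "\<dots> = (\<Prod>e\<in>I. measure_pmf.expectation (bernoulli_pmf (r e)) (\<lambda>b. exp (t * c e * of_bool b)))"
    by (rule expectation_prod_Pi_pmf[where f = "\<lambda>e b. exp (t * c e * of_bool b)"])
       (auto intro: fin integrable_measure_pmf_finite)
  also have "\<dots> \<le> (\<Prod>e\<in>I. exp ((t + 2 * t\<^sup>2) * (c e * r e)))"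
  proof (intro prod_mono conjI)
    fix e assume e: "e \<in> I"
    have "\<bar>t * c e\<bar> \<le> 1 / 2 * 2"
      unfolding abs_mult using t c[OF e] by (intro mult_mono) auto
    then have "exp (t * c e) - 1 \<le> t * c e + (t * c e)\<^sup>2"
      using exp_le_quadratic[of "t * c e"] by simp
    also have "(t * c e)\<^sup>2 \<le> 2 * t\<^sup>2 * c e"
    proof -
      have "t\<^sup>2 * c e * c e \<le> t\<^sup>2 * c e * 2"
        using c[OF e] by (intro mult_left_mono mult_nonneg_nonneg) auto
      then show ?thesis by (simp add: power_mult_distrib power2_eq_square mult_ac)
    qed
    finally have le: "r e * (exp (t * c e) - 1) \<le> r e * (t * c e + 2 * t\<^sup>2 * c e)"
      using r[OF e] by (intro mult_left_mono) auto
    have "measure_pmf.expectation (bernoulli_pmf (r e)) (\<lambda>b. exp (t * c e * of_bool b)) =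
        1 + r e * (exp (t * c e) - 1)"
      using r[OF e] by (subst integral_bernoulli_pmf) (auto simp: algebra_simps)
    also have "\<dots> \<le> exp (r e * (exp (t * c e) - 1))"
      by (rule exp_ge_add_one_self)
    also have "\<dots> \<le> exp (r e * (t * c e + 2 * t\<^sup>2 * c e))"
      using le by (simp only: exp_le_cancel_iff)
    also have "\<dots> = exp ((t + 2 * t\<^sup>2) * (c e * r e))"
      by (simp add: algebra_simps)
    finally show "measure_pmf.expectation (bernoulli_pmf (r e)) (\<lambda>b. exp (t * c e * of_bool b)) \<le>
        exp ((t + 2 * t\<^sup>2) * (c e * r e))" .
  qed (auto intro!: Bochner_Integration.integral_nonneg)
  also have "\<dots> = exp ((t + 2 * t\<^sup>2) * (\<Sum>e\<in>I. c e * r e))"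
    by (simp add: exp_sum[OF fin] sum_distrib_left)
  finally show ?thesis .
qed

text \<open>Leaving the sign of \<open>t\<close> open covers both tails by one exponential Markov
  inequality.\<close>

lemma markov_weighted_bernoulli:
  assumes t: "\<bar>t\<bar> \<le> 1 / 2"
  shows "measure_pmf.prob (Pi_pmf I False (\<lambda>e. bernoulli_pmf (r e)))
      {\<epsilon>. t * x \<le> t * (\<Sum>e\<in>I. c e * of_bool (\<epsilon> e))} \<le> exp ((t + 2 * t\<^sup>2) * (\<Sum>e\<in>I. c e * r e) - t * x)"
proof -
  let ?P = "Pi_pmf I False (\<lambda>e. bernoulli_pmf (r e))"
  let ?X = "\<lambda>\<epsilon>. \<Sum>e\<in>I. c e * of_bool (\<epsilon> e)"
  let ?A = "{\<epsilon>. t * x \<le> t * ?X \<epsilon>}"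
  have "finite (PiE_dflt I False (\<lambda>_. UNIV :: bool set))"
    using fin by (intro finite_PiE_dflt) auto
  then have finP: "finite (set_pmf ?P)"
    by (rule finite_subset[rotated]) (use fin in \<open>auto simp: set_Pi_pmf PiE_dflt_def\<close>)
  have "measure_pmf.prob ?P ?A = measure_pmf.expectation ?P (indicator ?A)"
    by simp
  also have "\<dots> \<le> measure_pmf.expectation ?P (\<lambda>\<epsilon>. exp (- (t * x)) * exp (t * ?X \<epsilon>))"
    using finP by (intro integral_mono integrable_measure_pmf_finite)
      (auto simp: indicator_def exp_add[symmetric])
  also have "\<dots> = exp (- (t * x)) * measure_pmf.expectation ?P (\<lambda>\<epsilon>. exp (t * ?X \<epsilon>))"
    by simp
  also have "\<dots> \<le> exp (- (t * x)) * exp ((t + 2 * t\<^sup>2) * (\<Sum>e\<in>I. c e * r e))"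
    by (intro mult_left_mono mgf_weighted_bernoulli_le t) auto
  finally show ?thesis by (simp add: exp_add[symmetric])
qed

lemma chernoff_weighted_bernoulli:
  assumes \<delta>: "0 < \<delta>" "\<delta> \<le> 2" and \<mu>: "\<mu> = (\<Sum>e\<in>I. c e * r e)"
  shows "measure_pmf.prob (Pi_pmf I False (\<lambda>e. bernoulli_pmf (r e)))
      {\<epsilon>. (1 + \<delta>) * \<mu> \<le> (\<Sum>e\<in>I. c e * of_bool (\<epsilon> e))} \<le> exp (- (\<delta>\<^sup>2 * \<mu> / 8))"
    and "measure_pmf.prob (Pi_pmf I False (\<lambda>e. bernoulli_pmf (r e)))
      {\<epsilon>. (\<Sum>e\<in>I. c e * of_bool (\<epsilon> e)) \<le> (1 - \<delta>) * \<mu>} \<le> exp (- (\<delta>\<^sup>2 * \<mu> / 8))"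
proof -
  let ?X = "\<lambda>\<epsilon>. \<Sum>e\<in>I. c e * of_bool (\<epsilon> e)"
  \<comment> \<open>The choice \<open>t = \<delta> / 4\<close> minimises
    \<open>2 * t\<^sup>2 - \<delta> * t\<close>, with value \<open>- (\<delta>\<^sup>2 / 8)\<close>;
    the lower tail uses its negative. The bound \<open>\<delta> \<le> 2\<close> keeps
    \<open>t\<close> in the admissible range.\<close>
  have t: "\<bar>\<delta> / 4\<bar> \<le> 1 / 2" "\<bar>- (\<delta> / 4)\<bar> \<le> 1 / 2"
    using \<delta> by simp_all
  have "\<delta> / 4 * x \<le> \<delta> / 4 * y \<longleftrightarrow> x \<le> y" for x y :: real
    using \<delta> by (intro mult_le_cancel_left_pos) simp
  moreover have "(\<delta> / 4 + 2 * (\<delta> / 4)\<^sup>2) * \<mu> - \<delta> / 4 * ((1 + \<delta>) * \<mu>) = - (\<delta>\<^sup>2 * \<mu> / 8)"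
    by (simp add: power2_eq_square algebra_simps)
  ultimately show "measure_pmf.prob (Pi_pmf I False (\<lambda>e. bernoulli_pmf (r e)))
      {\<epsilon>. (1 + \<delta>) * \<mu> \<le> ?X \<epsilon>} \<le> exp (- (\<delta>\<^sup>2 * \<mu> / 8))"
    using markov_weighted_bernoulli[OF t(1), of "(1 + \<delta>) * \<mu>"] by (simp only: \<mu>[symmetric])
  have "- (\<delta> / 4) * x \<le> - (\<delta> / 4) * y \<longleftrightarrow> y \<le> x" for x y :: real
    using \<delta> by (intro mult_le_cancel_left_neg) simp
  moreover have "(- (\<delta> / 4) + 2 * (- (\<delta> / 4))\<^sup>2) * \<mu> - - (\<delta> / 4) * ((1 - \<delta>) * \<mu>) = - (\<delta>\<^sup>2 * \<mu> / 8)"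
    by (simp add: power2_eq_square field_simps)
  ultimately show "measure_pmf.prob (Pi_pmf I False (\<lambda>e. bernoulli_pmf (r e)))
      {\<epsilon>. ?X \<epsilon> \<le> (1 - \<delta>) * \<mu>} \<le> exp (- (\<delta>\<^sup>2 * \<mu> / 8))"
    using markov_weighted_bernoulli[OF t(2), of "(1 - \<delta>) * \<mu>"] by (simp only: \<mu>[symmetric])
qed

end

lemma edge_prob_doubleton: "edge_prob B p q {u, v} = (if B u = B v then p (B u) else q)"
  by (auto simp: edge_prob_def is_singleton_def doubleton_eq_iff)

text \<open>\<open>J\<close> may contain both orientations of an edge, whose indicators coincide.
  Grouped by unordered pairs, the summands are independent with weights in [0, 2].\<close>

lemma sbm_chernoff:
  fixes B :: "nat \<Rightarrow> nat" and p :: "nat \<Rightarrow> real" and q :: real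
  assumes B: "B ` vertices N \<subseteq> {1..M}" and p: "\<And>m. m \<in> {1..M} \<Longrightarrow> p m \<in> {0..1}" and q: "q \<in> {0..1}"
    and J: "J \<subseteq> vertices N \<times> vertices N" and \<delta>: "0 < \<delta>" "\<delta> \<le> 2"
    and \<mu>: "\<mu> = (\<Sum>(u, v)\<in>J. edge_prob B p q {u, v})"
  shows "measure_pmf.prob (sbm N B p q) {E. (1 + \<delta>) * \<mu> \<le> (\<Sum>(u, v)\<in>J. real (adj E u v))}
      \<le> exp (- (\<delta>\<^sup>2 * \<mu> / 8))"
    and "measure_pmf.prob (sbm N B p q) {E. (\<Sum>(u, v)\<in>J. real (adj E u v)) \<le> (1 - \<delta>) * \<mu>}
      \<le> exp (- (\<delta>\<^sup>2 * \<mu> / 8))"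
proof -
  let ?I = "vertex_pairs N" and ?r = "edge_prob B p q"
  let ?c = "\<lambda>e. real (card {x\<in>J. {fst x, snd x} = e})"
  have r: "?r e \<in> {0..1}" if e: "e \<in> ?I" for e
  proof -
    obtain u v where "e = {u, v}" "u \<in> vertices N" "v \<in> vertices N"
      using e unfolding vertex_pairs_def by blast
    moreover from this B have "B u \<in> {1..M}" by blast
    ultimately show ?thesis using p[of "B u"] q by (auto simp: edge_prob_doubleton)
  qed
  have c: "?c e \<in> {0..2}" for e
    using card_ordered_pairs_le_2[of J e] by simp
  have \<mu>': "\<mu> = (\<Sum>e\<in>?I. ?c e * ?r e)"
    unfolding \<mu> by (rule sum_ordered_pairs[OF J])
  have X: "(\<Sum>(u, v)\<in>J. real (adj {e \<in> ?I. \<epsilon> e} u v)) = (\<Sum>e\<in>?I. ?c e * of_bool (\<epsilon> e))" for \<epsilon>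
  proof -
    have "(\<Sum>(u, v)\<in>J. real (adj {e \<in> ?I. \<epsilon> e} u v)) = (\<Sum>(u, v)\<in>J. of_bool (\<epsilon> {u, v}))"
      using J by (intro sum.cong refl) (auto simp: adj_def)
    also have "\<dots> = (\<Sum>e\<in>?I. ?c e * of_bool (\<epsilon> e))"
      by (rule sum_ordered_pairs[OF J, where f = "\<lambda>e. of_bool (\<epsilon> e)"])
    finally show ?thesis .
  qed
  note ch = chernoff_weighted_bernoulli[where I = ?I and r = ?r and c = ?c, OF finite_vertex_pairs r c \<delta> \<mu>']
  show "measure_pmf.prob (sbm N B p q) {E. (1 + \<delta>) * \<mu> \<le> (\<Sum>(u, v)\<in>J. real (adj E u v))}
      \<le> exp (- (\<delta>\<^sup>2 * \<mu> / 8))"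
    using ch(1) by (simp only: sbm_def measure_map_pmf vimage_def mem_Collect_eq X)
  show "measure_pmf.prob (sbm N B p q) {E. (\<Sum>(u, v)\<in>J. real (adj E u v)) \<le> (1 - \<delta>) * \<mu>}
      \<le> exp (- (\<delta>\<^sup>2 * \<mu> / 8))"
    using ch(2) by (simp only: sbm_def measure_map_pmf vimage_def mem_Collect_eq X)
qed

lemma sbm_subset: "measure_pmf.prob (sbm N B p q) {E. E \<subseteq> vertex_pairs N} = 1"
  by (simp add: sbm_def vimage_def)

section \<open>Typical graphs in a fixed stochastic block model\<close>

locale block_model =
  fixes M N :: nat and B :: "nat \<Rightarrow> nat" and p :: "nat \<Rightarrow> real" and q :: real
  assumes M: "2 \<le> M" and dvd: "M dvd N" and blocks: "equal_blocks M N B"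
    and p: "\<And>m. m \<in> {1..M} \<Longrightarrow> p m \<in> {0..1}" and q: "q \<in> {0..1}"
begin

lemma block_in_range: "B ` vertices N \<subseteq> {1..M}"
  using blocks by (simp add: equal_blocks_def)

lemma block_mem: "v \<in> vertices N \<Longrightarrow> B v \<in> {1..M}"
  using block_in_range by blast

lemma card_block: "m \<in> {1..M} \<Longrightarrow> real (card {v \<in> vertices N. B v = m}) = real N / real M"
  using blocks dvd by (simp add: equal_blocks_def real_of_nat_div)

lemma card_other_blocks:
  assumes "v \<in> vertices N"
  shows "real (card {u \<in> vertices N. B u \<noteq> B v}) = real N - real N / real M"
proof -
  have "{u \<in> vertices N. B u \<noteq> B v} = vertices N - {u \<in> vertices N. B u = B v}" by auto
  then have "card {u \<in> vertices N. B u \<noteq> B v} = N - card {u \<in> vertices N. B u = B v}"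
    by (simp add: card_Diff_subset)
  moreover have "card {u \<in> vertices N. B u = B v} \<le> N"
    using card_mono[of "vertices N" "{u \<in> vertices N. B u = B v}"] by simp
  ultimately show ?thesis using card_block[OF block_mem[OF assms]] by (simp add: of_nat_diff)
qed

text \<open>The loop at \<open>v\<close> is included with the intra-block probability, so the
  expected degree is exactly the parameter of the block.\<close>

lemma sum_edge_prob_row:
  assumes v: "v \<in> vertices N"
  shows "(\<Sum>u\<in>vertices N. edge_prob B p q {v, u}) = block_degree M N p q (B v)"
proof -
  have "(\<Sum>u\<in>vertices N. edge_prob B p q {v, u}) =
      (\<Sum>u\<in>vertices N. p (B v) * of_bool (B u = B v) + q * of_bool (B u \<noteq> B v))"
    by (intro sum.cong refl) (auto simp: edge_prob_doubleton)
  also have "\<dots> = p (B v) * real (card {u \<in> vertices N. B u = B v}) + q * real (card {u \<in> vertices N. B u \<noteq> B v})"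
    by (simp add: sum.distrib sum_distrib_left[symmetric] Int_def)
  also have "\<dots> = block_degree M N p q (B v)"
    unfolding card_block[OF block_mem[OF v]] card_other_blocks[OF v]
    using M by (simp add: block_degree_def field_simps)
  finally show ?thesis .
qed

lemma sum_over_blocks:
  "(\<Sum>v\<in>vertices N. f (B v)) = real N / real M * (\<Sum>m=1..M. f m)" for f :: "nat \<Rightarrow> real"
proof -
  have "(\<Sum>v\<in>vertices N. f (B v)) = (\<Sum>m=1..M. \<Sum>v\<in>{v \<in> vertices N. B v = m}. f (B v))"
    using block_in_range by (intro sum.group[symmetric]) auto
  also have "\<dots> = (\<Sum>m=1..M. real (card {v \<in> vertices N. B v = m}) * f m)"
    by (intro sum.cong refl) simp
  also have "\<dots> = (\<Sum>m=1..M. real N / real M * f m)"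
    by (intro sum.cong refl) (simp only: card_block)
  finally show ?thesis by (simp add: sum_distrib_left)
qed

definition cut_pairs :: "nat set \<Rightarrow> (nat \<times> nat) set" where
  "cut_pairs T = {(u, v). u \<in> T \<and> v \<in> vertices N - T \<and> B u \<noteq> B v}"

text \<open>A vertex \<open>u\<close> of \<open>T\<close> sees \<open>N - N / M\<close> vertices in
  other blocks, of which \<open>t - s (B u)\<close> lie in \<open>T\<close>. Summing gives
  \<open>t * (N - N / M - t)\<close> plus the sum of the squares of \<open>s m\<close>, which is at
  least \<open>t\<^sup>2 / M\<close> by Cauchy-Schwarz. The result
  \<open>t * (N - t) * (1 - 1 / M)\<close> is at least \<open>t * N / 4\<close>, since both
  \<open>t / N\<close> and \<open>1 / M\<close> are at most 1/2.\<close>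

lemma card_cut_pairs_ge:
  assumes T: "T \<subseteq> vertices N" "2 * card T \<le> N"
  shows "real N * real (card T) / 4 \<le> real (card (cut_pairs T))"
proof -
  define s where "s m = real (card {v \<in> T. B v = m})" for m
  define t where "t = real (card T)"
  have finT: "finite T" using T(1) by (rule finite_subset) simp
  have sum_T: "(\<Sum>v\<in>T. f (B v)) = (\<Sum>m=1..M. s m * f m)" for f :: "nat \<Rightarrow> real"
  proof -
    have "(\<Sum>v\<in>T. f (B v)) = (\<Sum>m=1..M. \<Sum>v\<in>{v \<in> T. B v = m}. f (B v))"
      using block_in_range T finT by (intro sum.group[symmetric]) auto
    then show ?thesis by (simp add: s_def)
  qed
  have t_sum: "t = (\<Sum>m=1..M. s m)" using sum_T[of "\<lambda>_. 1"] by (simp add: t_def)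
  have row: "real (card {v \<in> vertices N - T. B u \<noteq> B v}) = real N - real N / real M - (t - s (B u))"
    if u: "u \<in> T" for u
  proof -
    have un: "{v \<in> vertices N. B v \<noteq> B u} = {v \<in> vertices N - T. B u \<noteq> B v} \<union> (T - {v \<in> T. B v = B u})"
      using T(1) by auto
    have "card {v \<in> vertices N. B v \<noteq> B u} = card {v \<in> vertices N - T. B u \<noteq> B v} + card (T - {v \<in> T. B v = B u})"
      unfolding un using finT by (intro card_Un_disjoint) auto
    moreover have "card (T - {v \<in> T. B v = B u}) = card T - card {v \<in> T. B v = B u}"
      using finT by (intro card_Diff_subset) auto
    moreover have "card {v \<in> T. B v = B u} \<le> card T"
      using finT by (intro card_mono) auto
    ultimately show ?thesis
      using card_other_blocks[of u] u T(1) by (auto simp: s_def t_def of_nat_diff)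
  qed
  have "cut_pairs T = (SIGMA u:T. {v \<in> vertices N - T. B u \<noteq> B v})"
    by (auto simp: cut_pairs_def)
  then have "real (card (cut_pairs T)) = (\<Sum>u\<in>T. real (card {v \<in> vertices N - T. B u \<noteq> B v}))"
    using finT by (simp add: card_SigmaI)
  also have "\<dots> = (\<Sum>u\<in>T. real N - real N / real M - t + s (B u))"
  proof (intro sum.cong refl)
    fix u assume "u \<in> T"
    from row[OF this] show "real (card {v \<in> vertices N - T. B u \<noteq> B v}) = real N - real N / real M - t + s (B u)"
      by linarith
  qed
  also have "\<dots> = t * (real N - real N / real M - t) + (\<Sum>m=1..M. s m * s m)"
    unfolding sum.distrib sum_T by (simp add: t_def)
  finally have card_eq: "real (card (cut_pairs T)) = t * (real N - real N / real M - t) + (\<Sum>m=1..M. s m * s m)" .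
  have "t\<^sup>2 \<le> real M * (\<Sum>m=1..M. s m * s m)"
    using Cauchy_Schwarz_ineq_sum[of "\<lambda>_. 1" s "{1..M}"] by (simp add: t_sum power2_eq_square)
  then have "t * t / real M \<le> (\<Sum>m=1..M. s m * s m)"
    using M by (simp add: power2_eq_square field_simps)
  then have "t * (real N - real N / real M - t) + t * t / real M \<le> real (card (cut_pairs T))"
    using card_eq by simp
  moreover have "t * (real N - real N / real M - t) + t * t / real M = t * ((real N - t) * (1 - 1 / real M))"
    using M by (simp add: field_simps)
  moreover have "t * (real N / 2 * (1 / 2)) \<le> t * ((real N - t) * (1 - 1 / real M))"
  proof (intro mult_left_mono mult_mono)
    show "real N / 2 \<le> real N - t" using T(2) by (simp add: t_def)
    show "1 / 2 \<le> 1 - 1 / real M" using M by (simp add: field_simps)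
  qed (use T(2) in \<open>auto simp: t_def\<close>)
  ultimately show ?thesis by (simp add: t_def mult_ac)
qed

definition inter :: "nat set set \<Rightarrow> nat \<Rightarrow> nat \<Rightarrow> real" where
  "inter E u v = real (adj E u v) * of_bool (B u \<noteq> B v)"

definition mean_degree_sum :: real where
  "mean_degree_sum = real N / real M * (\<Sum>m=1..M. block_degree M N p q m)"

text \<open>The factor 1/8 is half of the 1/4 in \<open>card_cut_pairs_ge\<close>, and
  \<open>2 * q * N\<close> is twice an upper bound for the mean inter-block degree. Sharp
  concentration is asked only of the degree of \<open>w\<close> and of the degree sum, so no union
  bound is spent on it.\<close>

definition typical :: "real \<Rightarrow> nat \<Rightarrow> nat set set \<Rightarrow> bool" where
  "typical \<epsilon> w E \<longleftrightarrow>
    (\<forall>T. T \<subseteq> vertices N \<longrightarrow> T \<noteq> {} \<longrightarrow> 2 * card T \<le> N \<longrightarrow>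
       q * real N / 8 * real (card T) \<le> (\<Sum>u\<in>T. \<Sum>v\<in>vertices N - T. inter E u v)) \<and>
    (\<forall>u\<in>vertices N. (\<Sum>v\<in>vertices N. inter E u v) \<le> 2 * q * real N) \<and>
    \<bar>real (vdegree N E w) - block_degree M N p q (B w)\<bar> \<le> \<epsilon> * block_degree M N p q (B w) \<and>
    \<bar>(\<Sum>v\<in>vertices N. real (vdegree N E v)) - mean_degree_sum\<bar> \<le> \<epsilon> * mean_degree_sum"

abbreviation P :: "nat set set set \<Rightarrow> real" where
  "P \<equiv> measure_pmf.prob (sbm N B p q)"

lemma sum_inter_cut:
  assumes "T \<subseteq> vertices N"
  shows "(\<Sum>u\<in>T. \<Sum>v\<in>vertices N - T. inter E u v) = (\<Sum>(u, v)\<in>cut_pairs T. real (adj E u v))"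
proof -
  have fin: "finite T" using assms by (rule finite_subset) simp
  have "(\<Sum>u\<in>T. \<Sum>v\<in>vertices N - T. inter E u v) = (\<Sum>(u, v)\<in>T \<times> (vertices N - T). inter E u v)"
    by (rule sum.cartesian_product)
  also have "\<dots> = (\<Sum>(u, v)\<in>cut_pairs T. real (adj E u v))"
    using fin by (intro sum.mono_neutral_cong_right) (auto simp: cut_pairs_def inter_def)
  finally show ?thesis .
qed

text \<open>The mean is at least \<open>q * N * card T / 4\<close>. Falling to half of it has
  Chernoff exponent \<open>(1 / 2)\<^sup>2 / 8\<close> times the mean, hence 128; the form of a
  power in \<open>card T\<close> prepares the union bound.\<close>

lemma prob_cut_le:
  assumes T: "T \<subseteq> vertices N" "2 * card T \<le> N"
  shows "P {E. (\<Sum>u\<in>T. \<Sum>v\<in>vertices N - T. inter E u v) < q * real N / 8 * real (card T)}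
    \<le> exp (- (q * real N / 128)) ^ card T"
proof -
  define \<mu> where "\<mu> = (\<Sum>(u, v)\<in>cut_pairs T. edge_prob B p q {u, v})"
  have "\<mu> = (\<Sum>x\<in>cut_pairs T. q)"
    unfolding \<mu>_def by (intro sum.cong refl) (auto simp: cut_pairs_def edge_prob_doubleton)
  then have \<mu>_eq: "\<mu> = q * real (card (cut_pairs T))" by simp
  have \<mu>_ge: "q * (real N * real (card T) / 4) \<le> \<mu>"
    unfolding \<mu>_eq using q card_cut_pairs_ge[OF T] by (intro mult_left_mono) auto
  have "{E. (\<Sum>u\<in>T. \<Sum>v\<in>vertices N - T. inter E u v) < q * real N / 8 * real (card T)} \<subseteq>
      {E. (\<Sum>(u, v)\<in>cut_pairs T. real (adj E u v)) \<le> (1 - 1 / 2) * \<mu>}"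
    using \<mu>_ge by (auto simp: sum_inter_cut[OF T(1)])
  then have "P {E. (\<Sum>u\<in>T. \<Sum>v\<in>vertices N - T. inter E u v) < q * real N / 8 * real (card T)} \<le>
      P {E. (\<Sum>(u, v)\<in>cut_pairs T. real (adj E u v)) \<le> (1 - 1 / 2) * \<mu>}"
    by (intro measure_pmf.finite_measure_mono) auto
  also have "\<dots> \<le> exp (- ((1 / 2)\<^sup>2 * \<mu> / 8))"
    using T(1) by (intro sbm_chernoff(2)[OF block_in_range p q _ _ _ \<mu>_def]) (auto simp: cut_pairs_def)
  also have "\<dots> \<le> exp (real (card T) * (- (q * real N / 128)))"
    using \<mu>_ge by (simp add: power2_eq_square)
  also have "\<dots> = exp (- (q * real N / 128)) ^ card T"
    by (rule exp_of_nat_mult)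
  finally show ?thesis .
qed

lemma prob_inter_degree_le:
  assumes v: "v \<in> vertices N"
  shows "P {E. 2 * q * real N < (\<Sum>u\<in>vertices N. inter E v u)} \<le> exp (- (q * real N / 128))"
proof -
  let ?J = "Pair v ` {u \<in> vertices N. B u \<noteq> B v}"
  define \<mu> where "\<mu> = (\<Sum>(u, v)\<in>?J. edge_prob B p q {u, v})"
  have X: "(\<Sum>(u, v)\<in>?J. real (adj E u v)) = (\<Sum>u\<in>vertices N. inter E v u)" for E
    by (subst sum.reindex) (auto simp: inj_on_def inter_def intro!: sum.mono_neutral_cong_left)
  have "\<mu> = (\<Sum>u\<in>{u \<in> vertices N. B u \<noteq> B v}. q)"
    unfolding \<mu>_def by (subst sum.reindex) (auto simp: inj_on_def edge_prob_doubleton intro!: sum.cong)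
  then have \<mu>_eq: "\<mu> = q * (real N - real N / real M)"
    using card_other_blocks[OF v] by simp
  have \<mu>_le: "\<mu> \<le> q * real N" unfolding \<mu>_eq using q by (intro mult_left_mono) auto
  have "real N / real M \<le> real N / 2" using M by (intro divide_left_mono) auto
  then have \<mu>_ge: "q * (real N / 2) \<le> \<mu>" unfolding \<mu>_eq using q by (intro mult_left_mono) auto
  have "P {E. 2 * q * real N < (\<Sum>u\<in>vertices N. inter E v u)} \<le>
      P {E. (1 + 1) * \<mu> \<le> (\<Sum>(u, v)\<in>?J. real (adj E u v))}"
    unfolding X using \<mu>_le by (intro measure_pmf.finite_measure_mono) auto
  also have "\<dots> \<le> exp (- (1\<^sup>2 * \<mu> / 8))"
    using v by (intro sbm_chernoff(1)[OF block_in_range p q _ _ _ \<mu>_def]) auto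
  \<comment> \<open>The exponent is weakened on purpose, so that cuts and rows share the same
    base.\<close>
  also have "\<dots> \<le> exp (- (q * real N / 128))"
  proof -
    have "0 \<le> q * real N" using q by simp
    then have "q * real N / 128 \<le> 1\<^sup>2 * \<mu> / 8" using \<mu>_ge by simp
    then show ?thesis by simp
  qed
  finally show ?thesis .
qed

lemma prob_deviation_le:
  assumes J: "J \<subseteq> vertices N \<times> vertices N" and \<epsilon>: "0 < \<epsilon>" "\<epsilon> \<le> 2"
    and \<mu>: "\<mu> = (\<Sum>(u, v)\<in>J. edge_prob B p q {u, v})"
  shows "P {E. \<epsilon> * \<mu> < \<bar>(\<Sum>(u, v)\<in>J. real (adj E u v)) - \<mu>\<bar>} \<le> 2 * exp (- (\<epsilon>\<^sup>2 * \<mu> / 8))"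
proof -
  let ?X = "\<lambda>E. \<Sum>(u, v)\<in>J. real (adj E u v)"
  have "P {E. \<epsilon> * \<mu> < \<bar>?X E - \<mu>\<bar>} \<le> P ({E. (1 + \<epsilon>) * \<mu> \<le> ?X E} \<union> {E. ?X E \<le> (1 - \<epsilon>) * \<mu>})"
    by (intro measure_pmf.finite_measure_mono) (auto simp: algebra_simps abs_if split: if_splits)
  also have "\<dots> \<le> P {E. (1 + \<epsilon>) * \<mu> \<le> ?X E} + P {E. ?X E \<le> (1 - \<epsilon>) * \<mu>}"
    by (rule measure_Un_le) auto
  also have "\<dots> \<le> exp (- (\<epsilon>\<^sup>2 * \<mu> / 8)) + exp (- (\<epsilon>\<^sup>2 * \<mu> / 8))"
    by (intro add_mono sbm_chernoff[OF block_in_range p q J \<epsilon> \<mu>])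
  finally show ?thesis by simp
qed

lemma prob_not_typical_le:
  assumes w: "w \<in> vertices N" and \<epsilon>: "0 < \<epsilon>" "\<epsilon> \<le> 2"
  shows "P {E. \<not> typical \<epsilon> w E} \<le>
    (exp (real N * exp (- (q * real N / 128))) - 1) + real N * exp (- (q * real N / 128))
    + 2 * exp (- (\<epsilon>\<^sup>2 * block_degree M N p q (B w) / 8)) + 2 * exp (- (\<epsilon>\<^sup>2 * mean_degree_sum / 8))"
proof -
  let ?V = "vertices N"
  define \<rho> where "\<rho> = exp (- (q * real N / 128))"
  define \<gamma> where "\<gamma> = block_degree M N p q (B w)"
  define TT where "TT = {T. T \<subseteq> ?V \<and> T \<noteq> {} \<and> 2 * card T \<le> N}"
  define bad_cut where "bad_cut T = {E. (\<Sum>u\<in>T. \<Sum>v\<in>?V - T. inter E u v) < q * real N / 8 * real (card T)}" for T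
  define bad_row where "bad_row v = {E. 2 * q * real N < (\<Sum>u\<in>?V. inter E v u)}" for v
  define bad_w where "bad_w = {E. \<epsilon> * \<gamma> < \<bar>real (vdegree N E w) - \<gamma>\<bar>}"
  define bad_S where "bad_S = {E. \<epsilon> * mean_degree_sum < \<bar>(\<Sum>v\<in>?V. real (vdegree N E v)) - mean_degree_sum\<bar>}"
  have finTT: "finite TT"
    by (rule finite_subset[of _ "Pow ?V"]) (auto simp: TT_def)
  have cuts: "P (\<Union>T\<in>TT. bad_cut T) \<le> exp (real N * \<rho>) - 1"
  proof -
    have "P (\<Union>T\<in>TT. bad_cut T) \<le> (\<Sum>T\<in>TT. P (bad_cut T))"
      using finTT by (intro measure_pmf.finite_measure_subadditive_finite) auto
    also have "\<dots> \<le> (\<Sum>T\<in>TT. \<rho> ^ card T)"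
      unfolding bad_cut_def \<rho>_def by (intro sum_mono prob_cut_le) (auto simp: TT_def)
    also have "\<dots> \<le> (\<Sum>T\<in>Pow ?V - {{}}. \<rho> ^ card T)"
      by (intro sum_mono2) (auto simp: TT_def \<rho>_def)
    also have "\<dots> = (\<Sum>T\<in>Pow ?V. \<rho> ^ card T) - 1"
      by (subst sum_diff1) auto
    \<comment> \<open>The binomial theorem in the form of an expanded product over the vertices; the
      subtracted 1 is the term of the empty set.\<close>
    also have "(\<Sum>T\<in>Pow ?V. \<rho> ^ card T) = (\<rho> + 1) ^ N"
      using prod_add[of ?V "\<lambda>_. \<rho>" "\<lambda>_. 1"] by simp
    also have "\<dots> \<le> exp \<rho> ^ N"
      using exp_ge_add_one_self[of \<rho>] by (intro power_mono) (auto simp: \<rho>_def add.commute)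
    also have "\<dots> = exp (real N * \<rho>)" by (rule exp_of_nat_mult[symmetric])
    finally show ?thesis by simp
  qed
  have rows: "P (\<Union>v\<in>?V. bad_row v) \<le> real N * \<rho>"
  proof -
    have "P (\<Union>v\<in>?V. bad_row v) \<le> (\<Sum>v\<in>?V. P (bad_row v))"
      by (intro measure_pmf.finite_measure_subadditive_finite) auto
    also have "\<dots> \<le> (\<Sum>v\<in>?V. \<rho>)"
      unfolding bad_row_def \<rho>_def by (intro sum_mono prob_inter_degree_le)
    finally show ?thesis by simp
  qed
  have P_w: "P bad_w \<le> 2 * exp (- (\<epsilon>\<^sup>2 * \<gamma> / 8))"
  proof -
    have X: "(\<Sum>(u, v)\<in>{w} \<times> ?V. real (adj E u v)) = real (vdegree N E w)" for E
      by (simp add: sum.cartesian_product[symmetric] vdegree_def)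
    have "\<gamma> = (\<Sum>(u, v)\<in>{w} \<times> ?V. edge_prob B p q {u, v})"
      by (simp add: sum.cartesian_product[symmetric] \<gamma>_def sum_edge_prob_row[OF w])
    from prob_deviation_le[OF _ \<epsilon> this] w show ?thesis
      by (simp only: X bad_w_def) auto
  qed
  have P_S: "P bad_S \<le> 2 * exp (- (\<epsilon>\<^sup>2 * mean_degree_sum / 8))"
  proof -
    have X: "(\<Sum>(u, v)\<in>?V \<times> ?V. real (adj E u v)) = (\<Sum>v\<in>?V. real (vdegree N E v))" for E
      by (simp add: sum.cartesian_product[symmetric] vdegree_def)
    have "mean_degree_sum = (\<Sum>v\<in>?V. block_degree M N p q (B v))"
      unfolding mean_degree_sum_def by (rule sum_over_blocks[symmetric])
    also have "\<dots> = (\<Sum>(u, v)\<in>?V \<times> ?V. edge_prob B p q {u, v})"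
      by (simp add: sum.cartesian_product[symmetric] sum_edge_prob_row)
    finally show ?thesis
      using prob_deviation_le[OF subset_refl \<epsilon>] by (simp only: X bad_S_def)
  qed
  have "{E. \<not> typical \<epsilon> w E} \<subseteq> (\<Union>T\<in>TT. bad_cut T) \<union> (\<Union>v\<in>?V. bad_row v) \<union> bad_w \<union> bad_S"
    unfolding typical_def TT_def bad_cut_def bad_row_def bad_w_def bad_S_def \<gamma>_def
    by (auto simp: not_le)
  then have "P {E. \<not> typical \<epsilon> w E} \<le> P ((\<Union>T\<in>TT. bad_cut T) \<union> (\<Union>v\<in>?V. bad_row v) \<union> bad_w \<union> bad_S)"
    by (intro measure_pmf.finite_measure_mono) auto
  also have "\<dots> \<le> P ((\<Union>T\<in>TT. bad_cut T) \<union> (\<Union>v\<in>?V. bad_row v) \<union> bad_w) + P bad_S"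
    by (rule measure_Un_le) auto
  also have "P ((\<Union>T\<in>TT. bad_cut T) \<union> (\<Union>v\<in>?V. bad_row v) \<union> bad_w) \<le>
      P ((\<Union>T\<in>TT. bad_cut T) \<union> (\<Union>v\<in>?V. bad_row v)) + P bad_w"
    by (rule measure_Un_le) auto
  also have "P ((\<Union>T\<in>TT. bad_cut T) \<union> (\<Union>v\<in>?V. bad_row v)) \<le>
      P (\<Union>T\<in>TT. bad_cut T) + P (\<Union>v\<in>?V. bad_row v)"
    by (rule measure_Un_le) auto
  finally show ?thesis
    using cuts rows P_w P_S unfolding \<rho>_def \<gamma>_def by linarith
qed

lemma block_degree_ge:
  assumes "m \<in> {1..M}"
  shows "real N / real M * ((real M - 1) * q) \<le> block_degree M N p q m"
  using p[OF assms] by (simp add: block_degree_def mult_ac)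

lemma typical_imp:
  assumes w: "w \<in> vertices N" and \<epsilon>: "0 < \<epsilon>" "\<epsilon> \<le> 1 / 2" and N: "3 * M \<le> N" and q_pos: "0 < q"
    and E: "E \<subseteq> vertex_pairs N" and typical: "typical \<epsilon> w E"
  shows "graph_connected N E"
    and "\<bar>enn2real (avg_hitting_time N E w) / (mean_degree_sum / block_degree M N p q (B w)) - 1\<bar> \<le>
      max ((1 + \<epsilon>) / (1 - \<epsilon>) * (1 + sqrt ((1 + 3 * real M) * (256 / (q * real N))))\<^sup>2 - 1)
          (1 - (1 - \<epsilon>) / (1 + \<epsilon>) * (1 - 3 * real M / real N)\<^sup>2)"
proof -
  have Npos: "0 < real N" using N M by simp
  define h where "h = q * real N / 8"
  have h: "0 < h" using q_pos Npos by (simp add: h_def)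
  have expand: "h * real (card T) \<le> (\<Sum>u\<in>T. \<Sum>v\<in>vertices N - T. inter E u v)"
    if "T \<subseteq> vertices N" "T \<noteq> {}" "2 * card T \<le> N" for T
    using typical that unfolding typical_def h_def by blast
  have deg: "(\<Sum>v\<in>vertices N. inter E u v) \<le> 2 * q * real N" if "u \<in> vertices N" for u
    using typical that unfolding typical_def by blast
  have inter_le: "inter E u v \<le> real (adj E u v)" for u v
    by (simp add: inter_def)
  show "graph_connected N E"
    by (rule graph_connected_of_expansion[OF h inter_le expand])
  have sym: "inter E u v = inter E v u" for u v
    by (auto simp: inter_def adj_def insert_commute)
  have nonneg: "0 \<le> inter E u v" for u v by (simp add: inter_def)
  have "2 \<le> N" using N M by simp
  note bounds = avg_hitting_time_of_expansion[where N = N and E = E and w = w and b = "inter E" and h = h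
    and D = "2 * q * real N"]
  have lower: "(\<Sum>v\<in>vertices N. real (vdegree N E v)) / real (vdegree N E w) *
      (1 - real (vdegree N E w) / (\<Sum>v\<in>vertices N. real (vdegree N E v)))\<^sup>2 \<le> enn2real (avg_hitting_time N E w)"
    by (rule bounds(1); fact)
  have upper: "enn2real (avg_hitting_time N E w) \<le>
      (\<Sum>v\<in>vertices N. real (vdegree N E v)) / real (vdegree N E w) *
        (1 + sqrt ((1 + real (vdegree N E w) * real N / (\<Sum>v\<in>vertices N. real (vdegree N E v)))
          * (2 * (2 * q * real N) / h\<^sup>2)))\<^sup>2"
    by (rule bounds(2); fact)
  \<comment> \<open>The inverse of the Cheeger gap for expansion \<open>q * N / 8\<close> and
    maximal degree \<open>2 * q * N\<close>.\<close>
  have h_eq: "2 * (2 * q * real N) / h\<^sup>2 = 256 / (q * real N)"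
    using q_pos Npos by (simp add: h_def field_simps power2_eq_square)
  let ?\<gamma> = "block_degree M N p q"
  have \<gamma>_pos: "0 < ?\<gamma> m" if "m \<in> {1..M}" for m
    using M q_pos Npos by (intro less_le_trans[OF _ block_degree_ge[OF that]]) simp
  \<comment> \<open>Keeping only the block of \<open>w\<close> in the sum; this is the domination
    assumption of \<open>hitting_ratio_bound\<close>.\<close>
  have S0_ge: "real N / real M * ?\<gamma> (B w) \<le> mean_degree_sum"
    unfolding mean_degree_sum_def using block_mem[OF w] \<gamma>_pos
    by (intro mult_left_mono member_le_sum) (auto intro: less_imp_le)
  have S0_pos: "0 < mean_degree_sum"
    using \<gamma>_pos[OF block_mem[OF w]] M Npos by (intro less_le_trans[OF _ S0_ge]) simp
  show "\<bar>enn2real (avg_hitting_time N E w) / (mean_degree_sum / ?\<gamma> (B w)) - 1\<bar> \<le>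
      max ((1 + \<epsilon>) / (1 - \<epsilon>) * (1 + sqrt ((1 + 3 * real M) * (256 / (q * real N))))\<^sup>2 - 1)
          (1 - (1 - \<epsilon>) / (1 + \<epsilon>) * (1 - 3 * real M / real N)\<^sup>2)"
  proof (rule hitting_ratio_bound[OF \<epsilon> _ S0_pos Npos _ _ _ _ _ lower])
    show "0 < ?\<gamma> (B w)" by (rule \<gamma>_pos[OF block_mem[OF w]])
    show "3 * real M \<le> real N" using N by linarith
    show "0 < q * real N" using q_pos Npos by simp
    show "?\<gamma> (B w) * real N \<le> real M * mean_degree_sum"
      using S0_ge M by (simp add: field_simps)
    show "enn2real (avg_hitting_time N E w) \<le>
        (\<Sum>v\<in>vertices N. real (vdegree N E v)) / real (vdegree N E w) *
          (1 + sqrt ((1 + real (vdegree N E w) * real N / (\<Sum>v\<in>vertices N. real (vdegree N E v)))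
            * (256 / (q * real N))))\<^sup>2"
      using upper by (simp only: h_eq)
  qed (use typical in \<open>simp_all add: typical_def\<close>)
qed

end

subsection \<open>Asymptotics\<close>

text \<open>One of \<open>N * Pm\<close> and \<open>N * Q\<close> carries at least half of the total
  degree, whence the factor 2 in \<open>total\<close>. If it is \<open>N * Q\<close> the claim is
  immediate; otherwise \<open>N * Pm\<close> is large and \<open>q_cond\<close> transfers this to
  \<open>Q\<close>.\<close>

lemma inter_degree_ge:
  fixes N L Q Pm PM K M :: real
  assumes L: "K \<le> L" "1 \<le> L" and K: "1 \<le> K" and M: "1 \<le> M" and N: "0 < N" and Q: "0 < Q"
    and Pm: "0 \<le> Pm" "Pm \<le> PM"
    and total: "2 * K * L ^ 4 \<le> N * (Pm + Q)"
    and q_cond: "(M * L / N) powr (1 / 4) * Pm powr (5 / 4) * PM powr (1 / 2) \<le> Q\<^sup>2"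
  shows "K * L \<le> N * Q"
proof (cases "Pm \<le> Q")
  case True
  have "K * L \<le> K * L ^ 4"
    using L K by (intro mult_left_mono self_le_power) auto
  also have "K * L ^ 4 \<le> N * Q"
  proof -
    have "N * Pm \<le> N * Q" using True N by (intro mult_left_mono) auto
    then show ?thesis using total unfolding distrib_left mult.assoc by linarith
  qed
  finally show ?thesis .
next
  \<comment> \<open>The fourth power of the hypothesis on \<open>Q\<close> gives \<open>(N Q)^8 \<ge> L (N Pm)^7\<close>.\<close>
  case False
  then have Pm_pos: "0 < Pm" using Q by simp
  have c_pos: "0 < M * L / N" using M L N by simp
  have "N * Q \<le> N * Pm" using False N by (intro mult_left_mono) auto
  then have "K * L ^ 4 \<le> N * Pm"
    using total unfolding distrib_left mult.assoc by linarith
  then have "(K * L ^ 4) ^ 7 \<le> (N * Pm) ^ 7"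
    using K L by (intro power_mono) auto
  moreover have "(K * L) ^ 8 \<le> L * (K * L ^ 4) ^ 7"
  proof -
    have "K \<le> L ^ 21" using L(1) self_le_power[OF L(2), of 21] by simp
    then have "K * (K ^ 7 * L ^ 8) \<le> L ^ 21 * (K ^ 7 * L ^ 8)"
      using K L by (intro mult_right_mono) auto
    moreover have "K * (K ^ 7 * L ^ 8) = (K * L) ^ 8"
      using power_add[of K 1 7] by (simp add: power_mult_distrib)
    moreover have "L ^ 21 * (K ^ 7 * L ^ 8) = L * (K * L ^ 4) ^ 7"
      using power_add[of L 21 8] power_add[of L 1 28]
      by (simp add: power_mult_distrib power_mult[symmetric] mult.left_commute[of _ "K ^ 7"])
    ultimately show ?thesis by (simp only:)
  qed
  moreover have "L * (N * Pm) ^ 7 \<le> (N * Q) ^ 8"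
  proof -
    \<comment> \<open>Replacing \<open>PM\<close> by the smaller \<open>Pm\<close> collects the
      exponents 5/4 + 1/2 = 7/4, leaving a relation between \<open>Q\<close> and \<open>Pm\<close>
      alone.\<close>
    have "(M * L / N) powr (1 / 4) * Pm powr (7 / 4) =
        (M * L / N) powr (1 / 4) * Pm powr (5 / 4) * Pm powr (1 / 2)"
      by (simp add: powr_add[symmetric])
    also have "\<dots> \<le> (M * L / N) powr (1 / 4) * Pm powr (5 / 4) * PM powr (1 / 2)"
      using Pm by (intro mult_left_mono powr_mono2) auto
    also note q_cond
    finally have "((M * L / N) powr (1 / 4) * Pm powr (7 / 4)) ^ 4 \<le> (Q\<^sup>2) ^ 4"
      by (intro power_mono) auto
    moreover have fourth: "(z powr (a / 4)) ^ 4 = z powr a" if "0 < z" for z a :: real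
      using that powr_realpow[of "z powr (a / 4)" 4] by (simp add: powr_powr)
    have "((M * L / N) powr (1 / 4)) ^ 4 = M * L / N"
      unfolding fourth[OF c_pos] by (rule powr_one[OF less_imp_le[OF c_pos]])
    moreover have "(Pm powr (7 / 4)) ^ 4 = Pm ^ 7"
      unfolding fourth[OF Pm_pos] using powr_realpow[OF Pm_pos, of 7] by simp
    ultimately have "M * L / N * Pm ^ 7 \<le> Q ^ 8"
      by (simp add: power_mult_distrib power_mult[symmetric])
    then have "N ^ 8 * (M * L / N * Pm ^ 7) \<le> N ^ 8 * Q ^ 8"
      using N by (intro mult_left_mono) auto
    moreover have "N ^ 8 * (M * L / N * Pm ^ 7) = M * (L * (N * Pm) ^ 7)"
      using N power_add[of N 1 7] by (simp add: power_mult_distrib)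
    moreover have "L * (N * Pm) ^ 7 \<le> M * (L * (N * Pm) ^ 7)"
      using mult_right_mono[OF M, of "L * (N * Pm) ^ 7"] L N Pm by simp
    ultimately show ?thesis by (simp add: power_mult_distrib)
  qed
  moreover have "L * (K * L ^ 4) ^ 7 \<le> L * (N * Pm) ^ 7"
    using calculation(1) L by (intro mult_left_mono) auto
  ultimately have "(K * L) ^ 8 \<le> (N * Q) ^ 8" by linarith
  then have "(K * L) ^ Suc 7 \<le> (N * Q) ^ Suc 7" by simp
  then show ?thesis
    by (rule power_le_imp_le_base) (use N Q in simp)
qed

lemma filterlim_block_filter: "filterlim (\<lambda>N. N) sequentially (block_filter M)"
  unfolding filterlim_def block_filter_def by simp

lemma eventually_block_filter: "eventually (\<lambda>N. M dvd N \<and> M < N) (block_filter M)"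
  unfolding block_filter_def by (simp add: eventually_inf_principal)

text \<open>This is qN >> log N with an arbitrary constant. The degree condition is taken at block
  \<open>M\<close>, where the intra-block probability is minimal, and its factor
  \<open>block_degree_max ^ 2 / block_degree_min ^ 2\<close> is bounded below by 1.\<close>

lemma eventually_inter_degree_ge:
  fixes p :: "nat \<Rightarrow> nat \<Rightarrow> real" and q :: "nat \<Rightarrow> real"
  assumes "2 \<le> M"
    and p_range: "\<And>N m. M dvd N \<Longrightarrow> M < N \<Longrightarrow> m \<in> {1..M} \<Longrightarrow> p N m \<in> {0..1}"
    and p_antimono: "\<And>N m m'. M dvd N \<Longrightarrow> M < N \<Longrightarrow> 1 \<le> m \<Longrightarrow> m \<le> m' \<Longrightarrow> m' \<le> M \<Longrightarrow> p N m' \<le> p N m"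
    and q_range: "\<And>N. M dvd N \<Longrightarrow> M < N \<Longrightarrow> q N \<in> {0..1}"
    and degree_nonzero: "\<forall>\<^sub>F N in block_filter M. block_degree_min M N (p N) (q N) \<noteq> 0"
    and degree_cond: "\<And>m. m \<in> {1..M} \<Longrightarrow>
      ((\<lambda>N. real M * ln (real N) ^ 4 / (real N * p N m + real N * (real M - 1) * q N)
            * (block_degree_max M N (p N) (q N) ^ 2 / block_degree_min M N (p N) (q N) ^ 2))
        \<longlongrightarrow> 0) (block_filter M)"
    and q_cond: "much_less (block_filter M)
      (\<lambda>N. (real M * ln (real N) / real N) powr (1 / 4)
            * (MIN m\<in>{1..M}. p N m) powr (5 / 4) * (MAX m\<in>{1..M}. p N m) powr (1 / 2))
      (\<lambda>N. ((real M - 1) * q N) ^ 2)"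
    and K: "1 \<le> K"
  shows "\<forall>\<^sub>F N in block_filter M. K * ln (real N) \<le> q N * real N"
proof -
  \<comment> \<open>The extra factor \<open>M\<close> pays for passing from
    \<open>(M - 1) * q N \<le> M * q N\<close> to \<open>q N\<close>.\<close>
  define K' where "K' = K * real M"
  have K': "1 \<le> K'" using K \<open>2 \<le> M\<close> mult_mono[of 1 K 1 "real M"] by (simp add: K'_def)
  let ?deg = "\<lambda>N. real M * ln (real N) ^ 4 / (real N * p N M + real N * (real M - 1) * q N)
            * (block_degree_max M N (p N) (q N) ^ 2 / block_degree_min M N (p N) (q N) ^ 2)"
  let ?q = "\<lambda>N. (real M * ln (real N) / real N) powr (1 / 4)
            * (MIN m\<in>{1..M}. p N m) powr (5 / 4) * (MAX m\<in>{1..M}. p N m) powr (1 / 2)"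
  have "\<forall>\<^sub>F N in block_filter M. ?deg N < 1 / (2 * K')"
    using degree_cond[of M] K' \<open>2 \<le> M\<close> by (intro order_tendstoD(2)[of _ 0]) auto
  moreover have "\<forall>\<^sub>F N in block_filter M. ?q N / ((real M - 1) * q N)\<^sup>2 < 1"
    using q_cond unfolding much_less_def by (intro order_tendstoD(2)[of _ 0]) auto
  moreover have "\<forall>\<^sub>F N in block_filter M. ((real M - 1) * q N)\<^sup>2 \<noteq> 0"
    using q_cond unfolding much_less_def by simp
  moreover have "filterlim (\<lambda>N. ln (real N)) at_top (block_filter M)"
    by (rule filterlim_compose[OF _ filterlim_block_filter]) real_asymp
  then have "\<forall>\<^sub>F N in block_filter M. max 1 K' \<le> ln (real N)"
    unfolding filterlim_at_top by (rule spec)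
  ultimately show ?thesis
    using degree_nonzero eventually_block_filter[of M]
  proof eventually_elim
    case (elim N)
    have ranges: "\<And>m. m \<in> {1..M} \<Longrightarrow> p N m \<in> {0..1}" and q01: "q N \<in> {0..1}"
      using p_range q_range elim(6) by auto
    define Q where "Q = (real M - 1) * q N"
    have N: "0 < real N" using elim(6) by simp
    have q_pos: "0 < q N" using elim(3) q01 by (auto simp: less_le)
    have Q: "0 < Q" using q_pos \<open>2 \<le> M\<close> by (simp add: Q_def)
    have ne: "{1..M} \<noteq> {}" using \<open>2 \<le> M\<close> by simp
    have Pmin: "(MIN m\<in>{1..M}. p N m) = p N M"
      using p_antimono[of N _ M] elim(6) \<open>2 \<le> M\<close> by (intro Min_eqI) auto
    have Pmax: "p N M \<le> (MAX m\<in>{1..M}. p N m)"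
      using \<open>2 \<le> M\<close> by (intro Max_ge) auto
    have PM0: "0 \<le> p N M" using ranges[of M] \<open>2 \<le> M\<close> by simp
    have deg_pos: "0 < block_degree M N (p N) (q N) m" if "m \<in> {1..M}" for m
      using ranges[OF that] Q N \<open>2 \<le> M\<close> q_pos unfolding block_degree_def
      by (intro add_nonneg_pos) auto
    have min_pos: "0 < block_degree_min M N (p N) (q N)"
      unfolding block_degree_min_def using ne deg_pos by (subst Min_gr_iff) auto
    have "block_degree_min M N (p N) (q N) \<le> block_degree M N (p N) (q N) M"
      unfolding block_degree_min_def using \<open>2 \<le> M\<close> by (intro Min_le) auto
    also have "\<dots> \<le> block_degree_max M N (p N) (q N)"
      unfolding block_degree_max_def using \<open>2 \<le> M\<close> by (intro Max_ge) auto
    finally have "block_degree_min M N (p N) (q N) ^ 2 \<le> block_degree_max M N (p N) (q N) ^ 2"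
      using min_pos by (intro power_mono) auto
    then have ratio: "1 \<le> block_degree_max M N (p N) (q N) ^ 2 / block_degree_min M N (p N) (q N) ^ 2"
      using min_pos by simp
    have den: "real N * p N M + real N * (real M - 1) * q N = real N * (p N M + Q)"
      by (simp add: Q_def algebra_simps)
    have den_pos: "0 < real N * (p N M + Q)" using N Q PM0 by simp
    have "real M * ln (real N) ^ 4 / (real N * (p N M + Q)) \<le> ?deg N"
      unfolding den using mult_left_mono[OF ratio, of "real M * ln (real N) ^ 4 / (real N * (p N M + Q))"]
        den_pos by simp
    with elim(1) have "real M * ln (real N) ^ 4 / (real N * (p N M + Q)) < 1 / (2 * K')"
      by linarith
    then have "2 * K' * (real M * ln (real N) ^ 4) < real N * (p N M + Q)"
      using den_pos K' by (simp add: field_simps)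
    moreover have "2 * K' * (1 * ln (real N) ^ 4) \<le> 2 * K' * (real M * ln (real N) ^ 4)"
      using K' \<open>2 \<le> M\<close> by (intro mult_left_mono mult_right_mono) auto
    ultimately have total: "2 * K' * ln (real N) ^ 4 \<le> real N * (p N M + Q)"
      by linarith
    have qc: "(real M * ln (real N) / real N) powr (1 / 4) * p N M powr (5 / 4)
        * (MAX m\<in>{1..M}. p N m) powr (1 / 2) \<le> Q\<^sup>2"
      using elim(2) Q unfolding Pmin Q_def[symmetric] by (simp add: divide_less_eq)
    have "K' * ln (real N) \<le> real N * Q"
      by (rule inter_degree_ge[OF _ _ K' _ N Q PM0 Pmax total qc]) (use elim(4) \<open>2 \<le> M\<close> in auto)
    also have "\<dots> \<le> real N * (real M * q N)"
      using N q_pos by (intro mult_left_mono mult_right_mono) (auto simp: Q_def)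
    finally have "real M * (K * ln (real N)) \<le> real M * (q N * real N)"
      by (simp add: K'_def mult_ac)
    then show ?case using \<open>2 \<le> M\<close> by simp
  qed
qed

theorem theorem1p2:
  fixes M :: nat
    and B :: "nat \<Rightarrow> nat \<Rightarrow> nat"
    and p :: "nat \<Rightarrow> nat \<Rightarrow> real"
    and q :: "nat \<Rightarrow> real"
    and w :: "nat \<Rightarrow> nat"
    and \<kappa> :: ennreal
  assumes "1 \<le> M"
    and blocks: "\<And>N. M dvd N \<Longrightarrow> M < N \<Longrightarrow> equal_blocks M N (B N)"
    and p_range: "\<And>N m. M dvd N \<Longrightarrow> M < N \<Longrightarrow> m \<in> {1..M} \<Longrightarrow> p N m \<in> {0..1}"
    and p_antimono: "\<And>N m m'. M dvd N \<Longrightarrow> M < N \<Longrightarrow> 1 \<le> m \<Longrightarrow> m \<le> m' \<Longrightarrow> m' \<le> M \<Longrightarrow> p N m' \<le> p N m"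
    and q_range: "\<And>N. M dvd N \<Longrightarrow> M < N \<Longrightarrow> q N \<in> {0..1}"
    and degree_nonzero: "\<forall>\<^sub>F N in block_filter M. block_degree_min M N (p N) (q N) \<noteq> 0"
    and degree_cond: "\<And>m. m \<in> {1..M} \<Longrightarrow>
      ((\<lambda>N. real M * ln (real N) ^ 4 / (real N * p N m + real N * (real M - 1) * q N)
            * (block_degree_max M N (p N) (q N) ^ 2 / block_degree_min M N (p N) (q N) ^ 2))
        \<longlongrightarrow> 0) (block_filter M)"
    and q_cond: "much_less (block_filter M)
      (\<lambda>N. (real M * ln (real N) / real N) powr (1 / 4)
            * (MIN m\<in>{1..M}. p N m) powr (5 / 4) * (MAX m\<in>{1..M}. p N m) powr (1 / 2))
      (\<lambda>N. ((real M - 1) * q N) ^ 2)"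
    and kappa: "((\<lambda>N. ennreal ((real M - 1) * q N) / ennreal (MIN m\<in>{1..M}. p N m)) \<longlongrightarrow> \<kappa>)
      (block_filter M)"
    and w: "\<And>N. M dvd N \<Longrightarrow> M < N \<Longrightarrow> w N \<in> vertices N"
  shows "\<exists>\<delta> :: nat \<Rightarrow> real. (\<delta> \<longlongrightarrow> 0) (block_filter M) \<and>
    ((\<lambda>N. measure_pmf.prob (sbm N (B N) (p N) (q N))
        {E. graph_connected N E \<and>
            \<bar>enn2real (avg_hitting_time N E (w N))
              / (real N / real M * ((\<Sum>m=1..M. block_degree M N (p N) (q N) m)
                                    / block_degree M N (p N) (q N) (B N (w N)))) - 1\<bar> \<le> \<delta> N})
      \<longlongrightarrow> 1) (block_filter M)"
proof (cases "block_filter M = bot")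
  \<comment> \<open>Along the trivial filter every limit holds; otherwise an eventually false
    statement is a contradiction.\<close>
  case nontrivial: False
  \<comment> \<open>For \<open>M = 1\<close> the right-hand side of \<open>q_cond\<close> vanishes, so that hypothesis fails.\<close>
  have "2 \<le> M"
  proof (rule ccontr)
    assume "\<not> 2 \<le> M"
    with \<open>1 \<le> M\<close> have "real M - 1 = 0" by simp
    with q_cond have "eventually (\<lambda>_. False) (block_filter M)"
      by (simp add: much_less_def)
    with nontrivial show False by (simp add: eventually_False)
  qed
  let ?F = "block_filter M"
  define x where "x N = q N * real N" for N
  \<comment> \<open>The exponent -1/4 balances two demands: \<open>\<epsilon> N\<close> tends to 0,
    yet \<open>(\<epsilon> N)\<^sup>2 * x N = sqrt (x N)\<close> tends to infinity, so the Chernoff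
    tails vanish.\<close>
  define \<epsilon> where "\<epsilon> N = 1 / sqrt (sqrt (x N))" for N
  define \<delta> where "\<delta> N = max ((1 + \<epsilon> N) / (1 - \<epsilon> N) * (1 + sqrt ((1 + 3 * real M) * (256 / x N)))\<^sup>2 - 1)
          (1 - (1 - \<epsilon> N) / (1 + \<epsilon> N) * (1 - 3 * real M / real N)\<^sup>2)" for N
  \<comment> \<open>In this order: cuts, inter-block degrees, and the four tails for the degree of
    \<open>w\<close> and the degree sum.\<close>
  define err where "err N = exp (1 / real N) - 1 + 1 / real N + 4 * exp (- (sqrt (x N) / 16))" for N
  define good where "good N = {E. graph_connected N E \<and>
            \<bar>enn2real (avg_hitting_time N E (w N))
              / (real N / real M * ((\<Sum>m=1..M. block_degree M N (p N) (q N) m)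
                                    / block_degree M N (p N) (q N) (B N (w N)))) - 1\<bar> \<le> \<delta> N}" for N
  have N_top: "filterlim (\<lambda>N. real N) at_top ?F"
    by (rule filterlim_compose[OF filterlim_real_sequentially filterlim_block_filter])
  \<comment> \<open>With 256 = 2 * 128 each cut factor \<open>exp (- (x N / 128))\<close> is at most
    \<open>1 / N\<^sup>2\<close>, so its product with \<open>N\<close> still tends to 0.\<close>
  have x_ge: "\<forall>\<^sub>F N in ?F. 256 * ln (real N) \<le> x N"
    unfolding x_def
    by (rule eventually_inter_degree_ge[OF \<open>2 \<le> M\<close> p_range p_antimono q_range degree_nonzero degree_cond q_cond]) auto
  have "filterlim (\<lambda>N. 256 * ln (real N)) at_top ?F"
    by (rule filterlim_compose[OF _ filterlim_block_filter]) real_asymp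
  then have x_top: "filterlim x at_top ?F"
    using x_ge by (rule filterlim_at_top_mono)
  have inv_N: "((\<lambda>N. 1 / real N) \<longlongrightarrow> 0) ?F"
    by (rule filterlim_compose[OF _ filterlim_block_filter]) real_asymp
  have inv_x: "((\<lambda>N. 256 / x N) \<longlongrightarrow> 0) ?F"
    by (rule filterlim_compose[OF _ x_top, of "\<lambda>x. 256 / x"]) real_asymp
  have eps_lim: "(\<epsilon> \<longlongrightarrow> 0) ?F"
    unfolding \<epsilon>_def by (rule filterlim_compose[OF _ x_top, of "\<lambda>x. 1 / sqrt (sqrt x)"]) real_asymp
  have exp_lim: "((\<lambda>N. exp (- (sqrt (x N) / 16))) \<longlongrightarrow> 0) ?F"
    by (rule filterlim_compose[OF _ x_top, of "\<lambda>x. exp (- (sqrt x / 16))"]) real_asymp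
  have "(\<delta> \<longlongrightarrow> max ((1 + 0) / (1 - 0) * (1 + sqrt ((1 + 3 * real M) * 0))\<^sup>2 - 1)
          (1 - (1 - 0) / (1 + 0) * (1 - 3 * real M * 0)\<^sup>2)) ?F"
  proof -
    have "((\<lambda>N. 3 * real M / real N) \<longlongrightarrow> 3 * real M * 0) ?F"
      using tendsto_mult_left[OF inv_N, of "3 * real M"] by simp
    then show ?thesis
      unfolding \<delta>_def by (intro tendsto_intros eps_lim inv_x) auto
  qed
  then have \<delta>_lim: "(\<delta> \<longlongrightarrow> 0) ?F" by simp
  have "(err \<longlongrightarrow> exp 0 - 1 + 0 + 4 * 0) ?F"
    unfolding err_def by (intro tendsto_intros inv_N exp_lim)
  then have err_lim: "(err \<longlongrightarrow> 0) ?F" by simp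
  \<comment> \<open>The fourth root of 16 is 2, which yields
    \<open>\<epsilon> N \<le> 1 / 2\<close>.\<close>
  have "\<forall>\<^sub>F N in ?F. 16 \<le> x N" "\<forall>\<^sub>F N in ?F. 3 * real M \<le> real N"
    using x_top N_top by (simp_all add: filterlim_at_top)
  then have prob_ge: "\<forall>\<^sub>F N in ?F. 1 - err N \<le> measure_pmf.prob (sbm N (B N) (p N) (q N)) (good N)"
    using x_ge eventually_block_filter[of M]
  proof eventually_elim
    case (elim N)
    interpret block_model M N "B N" "p N" "q N"
      by unfold_locales (use \<open>2 \<le> M\<close> elim blocks p_range q_range in auto)
    have wN: "w N \<in> vertices N" using w elim by simp
    have Npos: "0 < real N" using elim(2) \<open>2 \<le> M\<close> by linarith
    have q_pos: "0 < q N" using q elim(1) by (cases "q N = 0") (auto simp: x_def)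
    have "2 \<le> sqrt (sqrt (x N))"
      using elim(1) by (intro real_le_rsqrt) (auto intro: real_le_rsqrt)
    then have "1 / sqrt (sqrt (x N)) \<le> 1 / 2"
      by (intro frac_le) auto
    then have \<epsilon>: "0 < \<epsilon> N" "\<epsilon> N \<le> 1 / 2"
      using elim(1) by (simp_all add: \<epsilon>_def)
    have \<epsilon>_sq: "(\<epsilon> N)\<^sup>2 * x N = sqrt (x N)"
      using elim(1) by (simp add: \<epsilon>_def power_divide real_div_sqrt)
    let ?\<gamma> = "block_degree M N (p N) (q N)"
    \<comment> \<open>Inter-block edges alone give every mean degree at least half of
      \<open>x N\<close>, because \<open>(M - 1) / M \<ge> 1 / 2\<close>.\<close>
    have "1 / 2 * x N \<le> (real M - 1) / real M * x N"
      using \<open>2 \<le> M\<close> elim(1) by (intro mult_right_mono) (auto simp: field_simps)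
    also have "\<dots> = real N / real M * ((real M - 1) * q N)" by (simp add: x_def)
    finally have half: "1 / 2 * x N \<le> real N / real M * ((real M - 1) * q N)" .
    have \<gamma>_ge: "1 / 2 * x N \<le> ?\<gamma> m" if "m \<in> {1..M}" for m
      using half block_degree_ge[OF that] by linarith
    have "1 * ?\<gamma> (B N (w N)) \<le> real N / real M * (\<Sum>m=1..M. ?\<gamma> m)"
    proof (intro mult_mono)
      show "1 \<le> real N / real M" using elim(2) \<open>2 \<le> M\<close> by (simp add: field_simps)
      show "?\<gamma> (B N (w N)) \<le> (\<Sum>m=1..M. ?\<gamma> m)"
        using block_mem[OF wN] \<gamma>_ge elim(1) by (intro member_le_sum) force+
    qed (use \<gamma>_ge[OF block_mem[OF wN]] elim(1) in auto)
    then have S_ge: "1 / 2 * x N \<le> mean_degree_sum"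
      using \<gamma>_ge[OF block_mem[OF wN]] unfolding mean_degree_sum_def by linarith
    have tail: "exp (- ((\<epsilon> N)\<^sup>2 * y / 8)) \<le> exp (- (sqrt (x N) / 16))" if "1 / 2 * x N \<le> y" for y
    proof -
      have "(\<epsilon> N)\<^sup>2 * (1 / 2 * x N) \<le> (\<epsilon> N)\<^sup>2 * y" using that by (intro mult_left_mono) auto
      then show ?thesis using \<epsilon>_sq by simp
    qed
    have \<rho>: "real N * exp (- (q N * real N / 128)) \<le> 1 / real N"
    proof -
      have "exp (- (q N * real N / 128)) \<le> exp (- (2 * ln (real N)))"
        using elim(3) by (simp add: x_def)
      also have "\<dots> = 1 / (real N * real N)"
        using Npos by (simp add: exp_minus exp_double power2_eq_square inverse_eq_divide)
      finally show ?thesis using Npos by (simp add: field_simps)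
    qed
    have "P {E. \<not> typical (\<epsilon> N) (w N) E} \<le> err N"
    proof -
      have "exp (real N * exp (- (q N * real N / 128))) \<le> exp (1 / real N)"
        using \<rho> by simp
      then show ?thesis
        using prob_not_typical_le[OF wN \<epsilon>(1)] \<epsilon>(2) \<rho> tail[OF \<gamma>_ge[OF block_mem[OF wN]]] tail[OF S_ge]
        unfolding err_def by linarith
    qed
    moreover have "{E. E \<subseteq> vertex_pairs N} \<subseteq> good N \<union> {E. \<not> typical (\<epsilon> N) (w N) E}"
    proof -
      have "3 * M \<le> N" using elim(2) by linarith
      note imp = typical_imp[OF wN \<epsilon> this q_pos]
      have "E \<in> good N" if "E \<subseteq> vertex_pairs N" "typical (\<epsilon> N) (w N) E" for E
        using imp[OF that] unfolding good_def \<delta>_def x_def mean_degree_sum_def by simp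
      then show ?thesis by blast
    qed
    then have "P {E. E \<subseteq> vertex_pairs N} \<le> P (good N \<union> {E. \<not> typical (\<epsilon> N) (w N) E})"
      by (intro measure_pmf.finite_measure_mono) auto
    moreover have "P (good N \<union> {E. \<not> typical (\<epsilon> N) (w N) E}) \<le> P (good N) + P {E. \<not> typical (\<epsilon> N) (w N) E}"
      by (rule measure_Un_le) auto
    ultimately show ?case by (simp add: sbm_subset)
  qed
  have "((\<lambda>N. measure_pmf.prob (sbm N (B N) (p N) (q N)) (good N)) \<longlongrightarrow> 1) ?F"
  proof (rule tendsto_sandwich[OF prob_ge])
    show "((\<lambda>N. 1 - err N) \<longlongrightarrow> 1) ?F"
      using tendsto_diff[OF tendsto_const err_lim, of 1] by simp
    show "\<forall>\<^sub>F N in ?F. measure_pmf.prob (sbm N (B N) (p N) (q N)) (good N) \<le> 1"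
      by (intro always_eventually allI measure_pmf.prob_le_1)
  qed (rule tendsto_const)
  with \<delta>_lim show ?thesis unfolding good_def by blast
qed simp

end
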